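(* Let $X$ be a finite dimensional vector space over $\mathbb K=\mathbb R$ or $\mathbb C$, $A=S(X^* )$, $B=\wedge(X)$, and let $K=\mathbb K$ carry the Calaque--Felder--Ferrario--Rossi $A_\infty$-$A$-$B$-bimodule structure $\mathrm d_K$. There exists a strictly unital $A_\infty$-$A$-$A$-bimodule structure $\mathrm d_{\underline{\mathrm{End}}_B(K)}$ on $\underline{\mathrm{End}}_B(K)$ such that the derived action $\mathrm L_A$ descends to a quasi-isomorphism $A\to\underline{\mathrm{End}}_B(K)$ of strictly unital $A_\infty$-$A$-$A$-bimodules. The codifferential $\mathrm d_{\underline{\mathrm{End}}_B(K)}$ has Taylor components $$\bar{\mathrm d}^{0,0}=-s\circ\partial\circ s^{-1},\qquad \bar{\mathrm d}^{n,0}(a_1|\dots|a_n|\varphi)=s\circ\mathrm D^{n,0}(a_1|\dots|a_n|\varphi)\ (n\ge1),\qquad \bar{\mathrm d}^{0,m}(\varphi|a_1|\dots|a_m)=s\circ\mathrm D^{0,m}(\varphi|a_1|\dots|a_m)\ (m\ge1),$$ with $$\partial(\varphi)=(-1)^{|\varphi|+1}\varphi\circ\mathrm d_K+\mathrm d_K\circ\varphi,$$ $$\mathrm D^{n,0}(a_1|\dots|a_n|\varphi)=(-1)^{\sum_{i=1}^n(|a_i|-1)-1}\mathcal L_A(a_1|\dots|a_n)\circ\varphi,\qquad \mathrm D^{0,m}(\varphi|a_1|\dots|a_m)=(-1)^{|\varphi|}\varphi\circ\mathcal L_A(a_1|\dots|a_m),$$ and $\bar{\mathrm d}^{n,m}=0$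 otherwise.
   Context: **Bigraded conventions.** Objects are $\mathbb Z$-bigraded $\mathbb K$-vector spaces $M=\{M^i_j\}$ (upper index: cohomological; lower: internal). $\mathrm{Hom}^{r,s}(M,N)=\prod\mathrm{Hom}_{\mathbb K}(M^n_m,N^{n+r}_{m+s})$, $(M[n])^i_j=M^{i+n}_j$; $s:M\to M[1]$ is the suspension (degree $-1$); $|\cdot|$ is the cohomological degree; Koszul signs; $(m_1|\cdots|m_n)=sm_1\otimes\cdots\otimes sm_n$; $T(V)=\bigoplus_{k\ge0}V^{\otimes k}$ with deconcatenation. **$A_\infty$-structures.** An $A_\infty$-algebra is given by a bidegree $(1,0)$ coderivation $\mathrm d_A$ of $T(A[1])$ with $\mathrm d_A^2=0$ and Taylor components $\bar{\mathrm d}_A^n=-s\circ m_n\circ(s^{-1})^{\otimes n}$; an associative algebra with zero differential has only $\bar{\mathrm d}_A^2\neq0$. An $A_\infty$-$A$-$B$-bimodule $M$ is given by a bidegree $(1,0)$ codifferential, compatible with $\mathrm d_A,\mathrm d_B$ and squaring to zero, on $T(A[1])\otimes M[1]\otimes T(B[1])$, with Taylor components $\bar{\mathrm d}_M^{k,l}:A[1]^{\otimes k}\otimes M[1]\otimes B[1]^{\otimes l}\to M[1]$. $A$ is an $A_\infty$-$A$-$A$-bimodule via $\bar{\mathrm d}_A^{k,l}=\bar{\mathrm d}_A^{k+l+1}$. Morphisms are bidegree $(0,0)$ bicomodule maps $F$ commuting with codifferentials, with Taylor components $F^{k,l}$; a quasi-isomorphism is one for which $F^{0,0}$ is a quasi-isomorphism.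 Strictly unital structures: $1$ acts as identity through the binary operation and higher operations vanish when an algebra argument is $1$; strictly unital bimodule morphisms: $F^{k,l}$ with $k+l\ge1$ vanishes when an algebra argument is $1$. **The triple.** $A=S(X^* )$ with $A^0_i$ = homogeneous polynomials of degree $i$; $B=\wedge(X)$ with $B^i_{-i}=\wedge^iX$; both associative algebras with zero differential. $K=\mathbb K$ in bidegree $(0,0)$ carries the $A_\infty$-$A$-$B$-bimodule structure $\mathrm d_K$ constructed by Calaque--Felder--Ferrario--Rossi (Compos. Math. 147 (2011), 105--160) for the branes $U=X$, $V=\{0\}$, by a Feynman-graph expansion. It is a given datum with these properties: it has bidegree $(1,0)$ and is strictly unital; $\bar{\mathrm d}_K^{k,0}$, $\bar{\mathrm d}_K^{0,l}$ make $K$ the augmentation left $A$-module, resp. right $B$-module; $\bar{\mathrm d}_K^{k,l}(a_1|\dots|a_k|1|b_1|\dots|b_l)\ne0$ only if $\sum\deg a_i=\sum|b_j|=k+l-1$; and the derived actions $\mathrm L_A$ (below) and $\mathrm R_B:B\to\underline{\mathrm{End}}_A(K)^{op}$ (analogous) are quasi-isomorphisms of strictly unital $A_\infty$-algebras. **$\underline{\mathrm{End}}_B(K)$ and $\mathrm L_A$.** As a bigraded object $\underline{\mathrm{End}}_B(K)=\mathrm{Hom}(K[1]\otimes T(B[1]),K[1])$. Each element is identified with its unique lift to a $T(B[1])$-comodule endomorphism of $K[1]\otimes T(B[1])$, and $\circ$ denotes composition of such lifts (projected to $K[1]$); in $\partial$, $\mathrm d_K$ is the right $B$-module codifferential on $K[1]\otimes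 T(B[1])$. It is an $A_\infty$-algebra with $\bar{\mathrm d}^1=-s\circ\partial\circ s^{-1}$, $\bar{\mathrm d}^2(\varphi|\psi)=(-1)^{|\varphi|}s(\varphi\circ\psi)$. Put $\mathcal L_A(a_1|\dots|a_n)(1|b_1|\dots|b_q)=\bar{\mathrm d}_K^{n,q}(a_1|\dots|a_n|1|b_1|\dots|b_q)$, an element of $\underline{\mathrm{End}}_B(K)$ of cohomological degree $\sum(|a_i|-1)+1$. The derived left action is the $A_\infty$-algebra morphism $\mathrm L_A:A\to\underline{\mathrm{End}}_B(K)$ with Taylor components $\mathrm L_A(a_1|\dots|a_n)=s\circ\mathcal L_A(a_1|\dots|a_n)$, $n\ge1$. "Descends to a morphism of bimodules" means that the maps $(a_1|\dots|a_k|\bar a|\tilde a_1|\dots|\tilde a_l)\mapsto\mathrm L_A(a_1|\dots|a_k|\bar a|\tilde a_1|\dots|\tilde a_l)$ are the $(k,l)$-Taylor components of such a morphism. *)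

theory Defs
  imports Complex_Main "HOL-Library.Function_Algebras" "HOL-Library.Poly_Mapping"
begin

class real_or_complex = field +
  assumes iso_real_or_complex:
    "(\<exists>h :: 'a \<Rightarrow> real. bij h \<and> (\<forall>x y. h (x + y) = h x + h y \<and> h (x * y) = h x * h y)) \<or>
     (\<exists>h :: 'a \<Rightarrow> complex. bij h \<and> (\<forall>x y. h (x + y) = h x + h y \<and> h (x * y) = h x * h y))"

instance real :: real_or_complex
  by standard (intro disjI1 exI[of _ id], simp)

instance complex :: real_or_complex
  by standard (intro disjI2 exI[of _ id], simp)

text \<open>
  A bigraded vector space is a family of independent subspaces \<open>comp V i j\<close> (cohomological degree
  \<open>i\<close>, internal degree \<open>j\<close>) of an ambient vector space. Only homogeneous elements are meaningful.
  The suspension \<open>s\<close> is the identity on underlying vectors: an element of \<open>V[1]\<close> is represented by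
  an element of \<open>V\<close>, and the shift enters only through degrees.
\<close>

record ('k, 'v) bigraded =
  smul :: "'k \<Rightarrow> 'v \<Rightarrow> 'v"
  comp :: "int \<Rightarrow> int \<Rightarrow> 'v set"

definition bigraded_space :: "('k::field, 'v::ab_group_add) bigraded \<Rightarrow> bool" where
  "bigraded_space V \<longleftrightarrow>
     vector_space (smul V) \<and>
     (\<forall>i j. module.subspace (smul V) (comp V i j)) \<and>
     (\<forall>I x. finite I \<and> (\<forall>p\<in>I. x p \<in> comp V (fst p) (snd p)) \<and> (\<Sum>p\<in>I. x p) = 0
        \<longrightarrow> (\<forall>p\<in>I. x p = 0))"

definition homog :: "('k, 'v) bigraded \<Rightarrow> 'v set" where
  "homog V = (\<Union>i j. comp V i j)"

definition cdeg :: "('k, 'v::zero) bigraded \<Rightarrow> 'v \<Rightarrow> int" where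
  "cdeg V x = (if x = 0 then 0 else THE i. \<exists>j. x \<in> comp V i j)"

text \<open>Cohomological degree of the word \<open>(x\<^sub>1|\<dots>|x\<^sub>n)\<close> of \<open>T(V[1])\<close>.\<close>

definition sdeg :: "('k, 'v::zero) bigraded \<Rightarrow> 'v list \<Rightarrow> int" where
  "sdeg V xs = (\<Sum>x\<leftarrow>xs. cdeg V x - 1)"

definition has_degs :: "('k, 'v) bigraded \<Rightarrow> (int \<times> int) list \<Rightarrow> 'v list \<Rightarrow> bool" where
  "has_degs V ds xs \<longleftrightarrow> list_all2 (\<lambda>d x. x \<in> comp V (fst d) (snd d)) ds xs"

definition wdeg :: "(int \<times> int) list \<Rightarrow> int" where
  "wdeg ds = (\<Sum>d\<leftarrow>ds. fst d - 1)"

definition wint :: "(int \<times> int) list \<Rightarrow> int" where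
  "wint ds = (\<Sum>d\<leftarrow>ds. snd d)"

text \<open>
  A tensor space is the free vector space on words with homogeneous letters modulo the relations
  of multilinearity. A slot is a word with one letter left open.
  Words of \<open>T(A[1])\<close> are lists; words of \<open>T(A[1]) \<otimes> M[1] \<otimes> T(B[1])\<close> are triples.
\<close>

definition fscal :: "'k::field \<Rightarrow> ('w \<Rightarrow>\<^sub>0 'k) \<Rightarrow> ('w \<Rightarrow>\<^sub>0 'k)" where
  "fscal c = Poly_Mapping.map ((*) c)"

text \<open>Linear extension of a map on words, with values in a space with scalar multiplication \<open>sc\<close>.\<close>

definition lin_ext :: "('k::field \<Rightarrow> 'v \<Rightarrow> 'v) \<Rightarrow> ('w \<Rightarrow> 'v::ab_group_add) \<Rightarrow> ('w \<Rightarrow>\<^sub>0 'k) \<Rightarrow> 'v" where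
  "lin_ext sc h p = (\<Sum>w\<in>Poly_Mapping.keys p. sc (Poly_Mapping.lookup p w) (h w))"

definition slots_T :: "('k, 'a) bigraded \<Rightarrow> ('a \<Rightarrow> 'a list) set" where
  "slots_T A = {\<lambda>x. us @ x # vs | us vs. us \<in> lists (homog A) \<and> vs \<in> lists (homog A)}"

definition hlinear :: "('k, 'v) bigraded \<Rightarrow> ('k \<Rightarrow> 'u \<Rightarrow> 'u) \<Rightarrow> ('v::ab_group_add \<Rightarrow> 'u::ab_group_add) \<Rightarrow> bool" where
  "hlinear V sc g \<longleftrightarrow>
     (\<forall>i j. \<forall>x\<in>comp V i j. \<forall>y\<in>comp V i j. g (x + y) = g x + g y) \<and>
     (\<forall>c. \<forall>x\<in>homog V. g (smul V c x) = sc c (g x))"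

definition slot_rel :: "('k::field, 'v::ab_group_add) bigraded \<Rightarrow> ('v \<Rightarrow> 'w) \<Rightarrow> ('w \<Rightarrow>\<^sub>0 'k) set" where
  "slot_rel V c =
     {Poly_Mapping.single (c (x + y)) 1 - Poly_Mapping.single (c x) 1 - Poly_Mapping.single (c y) 1
        | x y. \<exists>i j. x \<in> comp V i j \<and> y \<in> comp V i j} \<union>
     {Poly_Mapping.single (c (smul V r x)) 1 - Poly_Mapping.single (c x) r | r x. x \<in> homog V}"

definition rel_T :: "('k::field, 'a::ab_group_add) bigraded \<Rightarrow> ('a list \<Rightarrow>\<^sub>0 'k) set" where
  "rel_T A = module.span fscal (\<Union>c\<in>slots_T A. slot_rel A c)"

definition words3 :: "('k, 'a) bigraded \<Rightarrow> ('k, 'm) bigraded \<Rightarrow> ('k, 'b) bigraded \<Rightarrow> ('a list \<times> 'm \<times> 'b list) set" where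
  "words3 A M B = lists (homog A) \<times> homog M \<times> lists (homog B)"

definition slots3_left where
  "slots3_left A M B = {\<lambda>x. (c x, m, bs) | c m bs. c \<in> slots_T A \<and> m \<in> homog M \<and> bs \<in> lists (homog B)}"

definition slots3_mid where
  "slots3_mid A B = {\<lambda>x. (as, x, bs) | as bs. as \<in> lists (homog A) \<and> bs \<in> lists (homog B)}"

definition slots3_right where
  "slots3_right A M B = {\<lambda>x. (as, m, c x) | c m as. c \<in> slots_T B \<and> m \<in> homog M \<and> as \<in> lists (homog A)}"

definition rel3 :: "('k::field, 'a::ab_group_add) bigraded \<Rightarrow> ('k, 'm::ab_group_add) bigraded \<Rightarrow>
    ('k, 'b::ab_group_add) bigraded \<Rightarrow> ('a list \<times> 'm \<times> 'b list \<Rightarrow>\<^sub>0 'k) set" where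
  "rel3 A M B = module.span fscal
     ((\<Union>c\<in>slots3_left A M B. slot_rel A c) \<union> (\<Union>c\<in>slots3_mid A B. slot_rel M c) \<union>
      (\<Union>c\<in>slots3_right A M B. slot_rel B c))"

definition multilinear_T where
  "multilinear_T A sc f \<longleftrightarrow> (\<forall>c\<in>slots_T A. hlinear A sc (\<lambda>x. f (c x)))"

definition multilinear3 where
  "multilinear3 A M B sc f \<longleftrightarrow>
     (\<forall>c\<in>slots3_left A M B. hlinear A sc (\<lambda>x. f (c x))) \<and>
     (\<forall>c\<in>slots3_mid A B. hlinear M sc (\<lambda>x. f (c x))) \<and>
     (\<forall>c\<in>slots3_right A M B. hlinear B sc (\<lambda>x. f (c x)))"

definition cocycles :: "('k, 'v::zero) bigraded \<Rightarrow> ('v \<Rightarrow> 'v) \<Rightarrow> int \<Rightarrow> int \<Rightarrow> 'v set" where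
  "cocycles V d i j = {z \<in> comp V i j. d z = 0}"

definition cohomologous :: "('k, 'v::ab_group_add) bigraded \<Rightarrow> ('v \<Rightarrow> 'v) \<Rightarrow> int \<Rightarrow> int \<Rightarrow> ('v \<times> 'v) set" where
  "cohomologous V d i j =
     {(z, z'). z \<in> cocycles V d i j \<and> z' \<in> cocycles V d i j \<and> z - z' \<in> d ` comp V (i - 1) j}"

definition cohomology :: "('k, 'v::ab_group_add) bigraded \<Rightarrow> ('v \<Rightarrow> 'v) \<Rightarrow> int \<Rightarrow> int \<Rightarrow> 'v set set" where
  "cohomology V d i j = cocycles V d i j // cohomologous V d i j"

definition induces_cohomology_iso where
  "induces_cohomology_iso V dV W dW f \<longleftrightarrow>
     (\<forall>i j. bij_betw (\<lambda>C. cohomologous W dW i j `` (f ` C)) (cohomology V dV i j) (cohomology W dW i j))"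

text \<open>
  A structure is given by its Taylor components, one function \<open>d\<close> on nonempty words; \<open>coder V d\<close>
  is the coderivation of \<open>T(V[1])\<close> (with respect to deconcatenation) with these components.
\<close>

definition coder :: "('k::field, 'a::ab_group_add) bigraded \<Rightarrow> ('a list \<Rightarrow> 'a) \<Rightarrow> 'a list \<Rightarrow> ('a list \<Rightarrow>\<^sub>0 'k)" where
  "coder V d w = (\<Sum>i\<le>length w. \<Sum>n\<in>{1..length w - i}.
     Poly_Mapping.single (take i w @ d (take n (drop i w)) # drop (i + n) w)
       ((-1) powi sdeg V (take i w)))"

definition ainf_algebra :: "('k::field, 'a::ab_group_add) bigraded \<Rightarrow> ('a list \<Rightarrow> 'a) \<Rightarrow> bool" where
  "ainf_algebra V d \<longleftrightarrow>
     bigraded_space V \<and>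
     multilinear_T V (smul V) d \<and>
     (\<forall>ds w. w \<noteq> [] \<and> has_degs V ds w \<longrightarrow> d w \<in> comp V (wdeg ds + 2) (wint ds)) \<and>
     (\<forall>w\<in>lists (homog V). lin_ext fscal (coder V d) (coder V d w) \<in> rel_T V)"

text \<open>
  For \<open>m\<^sub>2(1,a) = a = m\<^sub>2(a,1)\<close> the Koszul sign in \<open>d\<^sup>2 = -s \<circ> m\<^sub>2 \<circ> (s\<^sup>-\<^sup>1 \<otimes> s\<^sup>-\<^sup>1)\<close> gives
  \<open>d\<^sup>2(a|b) = (-1)\<^bsup>|a|\<^esup> s m\<^sub>2(a,b)\<close>.
\<close>

definition strictly_unital_algebra where
  "strictly_unital_algebra V d e \<longleftrightarrow>
     e \<in> comp V 0 0 \<and>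
     (\<forall>a\<in>homog V. d [e, a] = a \<and> d [a, e] = smul V ((-1) powi cdeg V a) a) \<and>
     (\<forall>w\<in>lists (homog V). length w \<noteq> 2 \<and> e \<in> set w \<longrightarrow> d w = 0)"

definition assoc_taylor :: "('k::field, 'a::ab_group_add) bigraded \<Rightarrow> ('a \<Rightarrow> 'a \<Rightarrow> 'a) \<Rightarrow> 'a list \<Rightarrow> 'a" where
  "assoc_taylor V mult w = (case w of [a, b] \<Rightarrow> smul V ((-1) powi cdeg V a) (mult a b) | _ \<Rightarrow> 0)"

text \<open>Lift of Taylor components \<open>f\<close> to a coalgebra morphism: sum over all cuts into nonempty blocks.\<close>

definition alg_mor_lift :: "('a list \<Rightarrow> 'b) \<Rightarrow> 'a list \<Rightarrow> ('b list \<Rightarrow>\<^sub>0 'k::field)" where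
  "alg_mor_lift f w = (\<Sum>ws | concat ws = w \<and> [] \<notin> set ws. Poly_Mapping.single (map f ws) 1)"

definition ainf_algebra_morphism where
  "ainf_algebra_morphism V dV W dW f \<longleftrightarrow>
     multilinear_T V (smul W) f \<and>
     (\<forall>ds w. w \<noteq> [] \<and> has_degs V ds w \<longrightarrow> f w \<in> comp W (wdeg ds + 1) (wint ds)) \<and>
     (\<forall>w\<in>lists (homog V).
        lin_ext fscal (coder W dW) (alg_mor_lift f w) - lin_ext fscal (alg_mor_lift f) (coder V dV w)
          \<in> rel_T W)"

definition su_algebra_quasi_iso where
  "su_algebra_quasi_iso V dV eV W dW eW f \<longleftrightarrow>
     ainf_algebra V dV \<and> strictly_unital_algebra V dV eV \<and>
     ainf_algebra W dW \<and> strictly_unital_algebra W dW eW \<and>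
     ainf_algebra_morphism V dV W dW f \<and>
     f [eV] = eW \<and>
     (\<forall>w\<in>lists (homog V). length w \<ge> 2 \<and> eV \<in> set w \<longrightarrow> f w = 0) \<and>
     induces_cohomology_iso V (\<lambda>x. dV [x]) W (\<lambda>x. dW [x]) (\<lambda>x. f [x])"

text \<open>
  \<open>codiff\<close> is the codifferential of \<open>T(A[1]) \<otimes> M[1] \<otimes> T(B[1])\<close>, compatible with those of \<open>T(A[1])\<close>
  and \<open>T(B[1])\<close>, with Taylor components \<open>dM\<close>.
\<close>

definition codiff :: "('k::field, 'a::ab_group_add) bigraded \<Rightarrow> ('a list \<Rightarrow> 'a) \<Rightarrow>
    ('k, 'b::ab_group_add) bigraded \<Rightarrow> ('b list \<Rightarrow> 'b) \<Rightarrow> ('k, 'm::ab_group_add) bigraded \<Rightarrow>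
    ('a list \<times> 'm \<times> 'b list \<Rightarrow> 'm) \<Rightarrow> 'a list \<times> 'm \<times> 'b list \<Rightarrow> ('a list \<times> 'm \<times> 'b list \<Rightarrow>\<^sub>0 'k)" where
  "codiff A dA B dB M dM = (\<lambda>(as, m, bs).
     lin_ext fscal (\<lambda>u. Poly_Mapping.single (u, m, bs) 1) (coder A dA as) +
     (\<Sum>i\<le>length as. \<Sum>j\<le>length bs.
        Poly_Mapping.single (take i as, dM (drop i as, m, take j bs), drop j bs)
          ((-1) powi sdeg A (take i as))) +
     fscal ((-1) powi (sdeg A as + cdeg M m - 1))
       (lin_ext fscal (\<lambda>v. Poly_Mapping.single (as, m, v) 1) (coder B dB bs)))"

definition ainf_bimodule where
  "ainf_bimodule A dA B dB M dM \<longleftrightarrow>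
     ainf_algebra A dA \<and> ainf_algebra B dB \<and> bigraded_space M \<and>
     multilinear3 A M B (smul M) dM \<and>
     (\<forall>ds as i j m es bs. has_degs A ds as \<and> m \<in> comp M i j \<and> has_degs B es bs \<longrightarrow>
        dM (as, m, bs) \<in> comp M (wdeg ds + i + wdeg es + 1) (wint ds + j + wint es)) \<and>
     (\<forall>w\<in>words3 A M B.
        lin_ext fscal (codiff A dA B dB M dM) (codiff A dA B dB M dM w) \<in> rel3 A M B)"

definition strictly_unital_bimodule where
  "strictly_unital_bimodule A eA B eB M dM \<longleftrightarrow>
     (\<forall>m\<in>homog M. dM ([eA], m, []) = m \<and> dM ([], m, [eB]) = smul M ((-1) powi cdeg M m) m) \<and>
     (\<forall>(as, m, bs)\<in>words3 A M B.
        length as + length bs \<ge> 2 \<and> (eA \<in> set as \<or> eB \<in> set bs) \<longrightarrow> dM (as, m, bs) = 0)"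

definition su_ainf_bimodule where
  "su_ainf_bimodule A dA eA B dB eB M dM \<longleftrightarrow>
     strictly_unital_algebra A dA eA \<and> strictly_unital_algebra B dB eB \<and>
     ainf_bimodule A dA B dB M dM \<and> strictly_unital_bimodule A eA B eB M dM"

definition diag_bimodule :: "('a list \<Rightarrow> 'a) \<Rightarrow> 'a list \<times> 'a \<times> 'a list \<Rightarrow> 'a" where
  "diag_bimodule dA = (\<lambda>(as, a, bs). dA (as @ a # bs))"

text \<open>Lift of Taylor components \<open>F\<close> to a bicomodule morphism.\<close>

definition bimod_mor_lift :: "('a list \<times> 'm \<times> 'b list \<Rightarrow> 'n) \<Rightarrow> 'a list \<times> 'm \<times> 'b list \<Rightarrow>
    ('a list \<times> 'n \<times> 'b list \<Rightarrow>\<^sub>0 'k::field)" where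
  "bimod_mor_lift F = (\<lambda>(as, m, bs). \<Sum>i\<le>length as. \<Sum>j\<le>length bs.
     Poly_Mapping.single (take i as, F (drop i as, m, take j bs), drop j bs) 1)"

definition ainf_bimodule_morphism where
  "ainf_bimodule_morphism A dA B dB M dM N dN F \<longleftrightarrow>
     multilinear3 A M B (smul N) F \<and>
     (\<forall>ds as i j m es bs. has_degs A ds as \<and> m \<in> comp M i j \<and> has_degs B es bs \<longrightarrow>
        F (as, m, bs) \<in> comp N (wdeg ds + i + wdeg es) (wint ds + j + wint es)) \<and>
     (\<forall>w\<in>words3 A M B.
        lin_ext fscal (codiff A dA B dB N dN) (bimod_mor_lift F w)
        - lin_ext fscal (bimod_mor_lift F) (codiff A dA B dB M dM w) \<in> rel3 A N B)"

definition su_bimodule_quasi_iso where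
  "su_bimodule_quasi_iso A dA eA B dB eB M dM N dN F \<longleftrightarrow>
     su_ainf_bimodule A dA eA B dB eB M dM \<and> su_ainf_bimodule A dA eA B dB eB N dN \<and>
     ainf_bimodule_morphism A dA B dB M dM N dN F \<and>
     (\<forall>(as, m, bs)\<in>words3 A M B.
        length as + length bs \<ge> 1 \<and> (eA \<in> set as \<or> eB \<in> set bs) \<longrightarrow> F (as, m, bs) = 0) \<and>
     induces_cohomology_iso M (\<lambda>m. dM ([], m, [])) N (\<lambda>n. dN ([], n, [])) (\<lambda>m. F ([], m, []))"

definition restrict0 :: "'w set \<Rightarrow> ('w \<Rightarrow> 'v::zero) \<Rightarrow> 'w \<Rightarrow> 'v" where
  "restrict0 W f w = (if w \<in> W then f w else 0)"

text \<open>
  An element of \<open>Hom(M[1] \<otimes> T(B[1]), M[1])\<close> is a multilinear map on the words \<open>(m|b\<^sub>1|\<dots>|b\<^sub>q)\<close>, set to 0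
  outside homogeneous words so that equality of functions is equality of elements.
\<close>

definition wordsR :: "('k, 'b) bigraded \<Rightarrow> ('k, 'm) bigraded \<Rightarrow> ('m \<times> 'b list) set" where
  "wordsR B M = homog M \<times> lists (homog B)"

definition EndR :: "('k::field, 'b::ab_group_add) bigraded \<Rightarrow> ('k, 'm::ab_group_add) bigraded \<Rightarrow>
    ('k, 'm \<times> 'b list \<Rightarrow> 'm) bigraded" where
  "EndR B M = \<lparr> smul = (\<lambda>c \<phi> w. smul M c (\<phi> w)),
     comp = (\<lambda>r s. {\<phi>.
       (\<forall>bs\<in>lists (homog B). hlinear M (smul M) (\<lambda>m. \<phi> (m, bs))) \<and>
       (\<forall>m\<in>homog M. multilinear_T B (smul M) (\<lambda>bs. \<phi> (m, bs))) \<and>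
       (\<forall>w. w \<notin> wordsR B M \<longrightarrow> \<phi> w = 0) \<and>
       (\<forall>i j m ds bs. m \<in> comp M i j \<and> has_degs B ds bs \<longrightarrow>
          \<phi> (m, bs) \<in> comp M (i + wdeg ds + r) (j + wint ds + s))}) \<rparr>"

text \<open>The lift to a comodule endomorphism of \<open>M[1] \<otimes> T(B[1])\<close>, and composition of lifts projected to \<open>M[1]\<close>.\<close>

definition liftR :: "('m \<times> 'b list \<Rightarrow> 'm) \<Rightarrow> 'm \<times> 'b list \<Rightarrow> ('m \<times> 'b list \<Rightarrow>\<^sub>0 'k::field)" where
  "liftR \<phi> = (\<lambda>(m, bs). \<Sum>j\<le>length bs. Poly_Mapping.single (\<phi> (m, take j bs), drop j bs) 1)"

definition compR :: "('k::field, 'm::ab_group_add) bigraded \<Rightarrow> ('m \<times> 'b list \<Rightarrow> 'm) \<Rightarrow>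
    ('m \<times> 'b list \<Rightarrow> 'm) \<Rightarrow> 'm \<times> 'b list \<Rightarrow> 'm" where
  "compR M \<phi> \<psi> = (\<lambda>w. lin_ext (smul M) \<phi> (liftR \<psi> w))"

definition right_part :: "('a list \<times> 'm \<times> 'b list \<Rightarrow> 'm) \<Rightarrow> 'm \<times> 'b list \<Rightarrow> 'm" where
  "right_part dM = (\<lambda>(m, bs). dM ([], m, bs))"

definition codiffR :: "('k::field, 'b::ab_group_add) bigraded \<Rightarrow> ('b list \<Rightarrow> 'b) \<Rightarrow>
    ('k, 'm::ab_group_add) bigraded \<Rightarrow> ('m \<times> 'b list \<Rightarrow> 'm) \<Rightarrow> 'm \<times> 'b list \<Rightarrow> ('m \<times> 'b list \<Rightarrow>\<^sub>0 'k)" where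
  "codiffR B dB M dr = (\<lambda>(m, bs). liftR dr (m, bs) +
     fscal ((-1) powi (cdeg M m - 1))
       (lin_ext fscal (\<lambda>v. Poly_Mapping.single (m, v) 1) (coder B dB bs)))"

text \<open>\<open>\<partial>\<phi> = (-1)\<^bsup>|\<phi>|+1\<^esup> \<phi> \<circ> d\<^sub>M + d\<^sub>M \<circ> \<phi>\<close>\<close>

definition partialR :: "('k::field, 'b::ab_group_add) bigraded \<Rightarrow> ('b list \<Rightarrow> 'b) \<Rightarrow>
    ('k, 'm::ab_group_add) bigraded \<Rightarrow> ('a list \<times> 'm \<times> 'b list \<Rightarrow> 'm) \<Rightarrow>
    ('m \<times> 'b list \<Rightarrow> 'm) \<Rightarrow> 'm \<times> 'b list \<Rightarrow> 'm" where
  "partialR B dB M dM \<phi> = restrict0 (wordsR B M) (\<lambda>w.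
     smul M ((-1) powi (cdeg (EndR B M) \<phi> + 1)) (lin_ext (smul M) \<phi> (codiffR B dB M (right_part dM) w)) +
     lin_ext (smul M) (right_part dM) (liftR \<phi> w))"

definition EndR_taylor where
  "EndR_taylor B dB M dM \<Phi> = (case \<Phi> of
       [\<phi>] \<Rightarrow> - partialR B dB M dM \<phi>
     | [\<phi>, \<psi>] \<Rightarrow> smul (EndR B M) ((-1) powi cdeg (EndR B M) \<phi>) (compR M \<phi> \<psi>)
     | _ \<Rightarrow> 0)"

definition EndR_unit :: "('k, 'b) bigraded \<Rightarrow> ('k, 'm::zero) bigraded \<Rightarrow> 'm \<times> 'b list \<Rightarrow> 'm" where
  "EndR_unit B M = restrict0 (wordsR B M) (\<lambda>(m, bs). if bs = [] then m else 0)"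

definition derived_left :: "('k, 'b) bigraded \<Rightarrow> ('k, 'm::zero) bigraded \<Rightarrow>
    ('a list \<times> 'm \<times> 'b list \<Rightarrow> 'm) \<Rightarrow> 'a list \<Rightarrow> 'm \<times> 'b list \<Rightarrow> 'm" where
  "derived_left B M dM as = restrict0 (wordsR B M) (\<lambda>(m, bs). dM (as, m, bs))"

text \<open>
  Mirror image of \<open>EndR\<close>, \<open>compR\<close>, \<open>partialR\<close>, with the Koszul signs for moving operators past
  \<open>T(A[1])\<close>. The opposite product is \<open>\<phi> \<cdot> \<psi> = (-1)\<^bsup>|\<phi>||\<psi>|\<^esup> \<psi> \<circ> \<phi>\<close>, and the sign in \<open>derived_right\<close> comes from moving
  \<open>(b\<^sub>1|\<dots>|b\<^sub>l)\<close> past \<open>(a\<^sub>1|\<dots>|a\<^sub>k|m)\<close>, normalised so that \<open>1\<close> acts as the identity.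
\<close>

definition wordsL :: "('k, 'a) bigraded \<Rightarrow> ('k, 'm) bigraded \<Rightarrow> ('a list \<times> 'm) set" where
  "wordsL A M = lists (homog A) \<times> homog M"

definition EndL :: "('k::field, 'a::ab_group_add) bigraded \<Rightarrow> ('k, 'm::ab_group_add) bigraded \<Rightarrow>
    ('k, 'a list \<times> 'm \<Rightarrow> 'm) bigraded" where
  "EndL A M = \<lparr> smul = (\<lambda>c \<phi> w. smul M c (\<phi> w)),
     comp = (\<lambda>r s. {\<phi>.
       (\<forall>as\<in>lists (homog A). hlinear M (smul M) (\<lambda>m. \<phi> (as, m))) \<and>
       (\<forall>m\<in>homog M. multilinear_T A (smul M) (\<lambda>as. \<phi> (as, m))) \<and>
       (\<forall>w. w \<notin> wordsL A M \<longrightarrow> \<phi> w = 0) \<and>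
       (\<forall>i j m ds as. m \<in> comp M i j \<and> has_degs A ds as \<longrightarrow>
          \<phi> (as, m) \<in> comp M (i + wdeg ds + r) (j + wint ds + s))}) \<rparr>"

definition liftL :: "('k::field, 'a::ab_group_add) bigraded \<Rightarrow> int \<Rightarrow> ('a list \<times> 'm \<Rightarrow> 'm) \<Rightarrow>
    'a list \<times> 'm \<Rightarrow> ('a list \<times> 'm \<Rightarrow>\<^sub>0 'k)" where
  "liftL A r \<phi> = (\<lambda>(as, m). \<Sum>i\<le>length as.
     Poly_Mapping.single (take i as, \<phi> (drop i as, m)) ((-1) powi (r * sdeg A (take i as))))"

definition compL :: "('k::field, 'a::ab_group_add) bigraded \<Rightarrow> ('k, 'm::ab_group_add) bigraded \<Rightarrow>
    ('a list \<times> 'm \<Rightarrow> 'm) \<Rightarrow> ('a list \<times> 'm \<Rightarrow> 'm) \<Rightarrow> 'a list \<times> 'm \<Rightarrow> 'm" where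
  "compL A M \<phi> \<psi> = (\<lambda>w. lin_ext (smul M) \<phi> (liftL A (cdeg (EndL A M) \<psi>) \<psi> w))"

definition left_part :: "('a list \<times> 'm \<times> 'b list \<Rightarrow> 'm) \<Rightarrow> 'a list \<times> 'm \<Rightarrow> 'm" where
  "left_part dM = (\<lambda>(as, m). dM (as, m, []))"

definition codiffL :: "('k::field, 'a::ab_group_add) bigraded \<Rightarrow> ('a list \<Rightarrow> 'a) \<Rightarrow>
    ('a list \<times> 'm \<Rightarrow> 'm) \<Rightarrow> 'a list \<times> 'm \<Rightarrow> ('a list \<times> 'm \<Rightarrow>\<^sub>0 'k)" where
  "codiffL A dA dl = (\<lambda>(as, m).
     lin_ext fscal (\<lambda>u. Poly_Mapping.single (u, m) 1) (coder A dA as) + liftL A 1 dl (as, m))"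

definition partialL :: "('k::field, 'a::ab_group_add) bigraded \<Rightarrow> ('a list \<Rightarrow> 'a) \<Rightarrow>
    ('k, 'm::ab_group_add) bigraded \<Rightarrow> ('a list \<times> 'm \<times> 'b list \<Rightarrow> 'm) \<Rightarrow>
    ('a list \<times> 'm \<Rightarrow> 'm) \<Rightarrow> 'a list \<times> 'm \<Rightarrow> 'm" where
  "partialL A dA M dM \<phi> = restrict0 (wordsL A M) (\<lambda>w.
     smul M ((-1) powi (cdeg (EndL A M) \<phi> + 1)) (lin_ext (smul M) \<phi> (codiffL A dA (left_part dM) w)) +
     lin_ext (smul M) (left_part dM) (liftL A (cdeg (EndL A M) \<phi>) \<phi> w))"

definition EndL_op_taylor where
  "EndL_op_taylor A dA M dM \<Phi> = (case \<Phi> of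
       [\<phi>] \<Rightarrow> - partialL A dA M dM \<phi>
     | [\<phi>, \<psi>] \<Rightarrow> smul (EndL A M)
         ((-1) powi (cdeg (EndL A M) \<phi> + cdeg (EndL A M) \<phi> * cdeg (EndL A M) \<psi>)) (compL A M \<psi> \<phi>)
     | _ \<Rightarrow> 0)"

definition EndL_unit :: "('k, 'a) bigraded \<Rightarrow> ('k, 'm::zero) bigraded \<Rightarrow> 'a list \<times> 'm \<Rightarrow> 'm" where
  "EndL_unit A M = restrict0 (wordsL A M) (\<lambda>(as, m). if as = [] then m else 0)"

definition derived_right :: "('k::field, 'a::ab_group_add) bigraded \<Rightarrow> ('k, 'b::ab_group_add) bigraded \<Rightarrow>
    ('k, 'm::ab_group_add) bigraded \<Rightarrow> ('a list \<times> 'm \<times> 'b list \<Rightarrow> 'm) \<Rightarrow> 'b list \<Rightarrow> 'a list \<times> 'm \<Rightarrow> 'm" where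
  "derived_right A B M dM bs = restrict0 (wordsL A M) (\<lambda>(as, m).
     smul M ((-1) powi (1 + sdeg B bs * (sdeg A as + cdeg M m - 1))) (dM (as, m, bs)))"

definition fun_scale :: "'k::field \<Rightarrow> ('p \<Rightarrow> 'k) \<Rightarrow> 'p \<Rightarrow> 'k" where
  "fun_scale c f = (\<lambda>p. c * f p)"

text \<open>Homogeneous polynomials of degree \<open>n\<close> on \<open>X\<close>: combinations of products of \<open>n\<close> elements of \<open>X\<^sup>*\<close>.\<close>

definition hom_poly :: "('k::field \<Rightarrow> 'x::ab_group_add \<Rightarrow> 'x) \<Rightarrow> nat \<Rightarrow> ('x \<Rightarrow> 'k) set" where
  "hom_poly sX n = module.span fun_scale
     {prod_list fs | fs. length fs = n \<and> (\<forall>f\<in>set fs. Vector_Spaces.linear sX (*) f)}"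

definition SymAlg :: "('k::field \<Rightarrow> 'x::ab_group_add \<Rightarrow> 'x) \<Rightarrow> ('k, 'x \<Rightarrow> 'k) bigraded" where
  "SymAlg sX = \<lparr> smul = fun_scale,
     comp = (\<lambda>i j. if i = 0 \<and> j \<ge> 0 then hom_poly sX (nat j) else {0}) \<rparr>"

definition SymAlg_taylor :: "('k::field \<Rightarrow> 'x::ab_group_add \<Rightarrow> 'x) \<Rightarrow> ('x \<Rightarrow> 'k) list \<Rightarrow> ('x \<Rightarrow> 'k)" where
  "SymAlg_taylor sX = assoc_taylor (SymAlg sX) (*)"

text \<open>
  The exterior algebra is \<open>T(X)\<close> modulo the ideal generated by the \<open>x \<otimes> x\<close>. A tensor lies in this ideal
  iff all alternating multilinear forms vanish on it, so the class of \<open>x\<^sub>1 \<otimes> \<dots> \<otimes> x\<^sub>n\<close> is represented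
  by evaluation of alternating forms at \<open>(x\<^sub>1,\<dots>,x\<^sub>n)\<close>. (A form is a function on words of all lengths.)
\<close>

definition alt_form :: "('k::field \<Rightarrow> 'x::ab_group_add \<Rightarrow> 'x) \<Rightarrow> ('x list \<Rightarrow> 'k) \<Rightarrow> bool" where
  "alt_form sX \<omega> \<longleftrightarrow>
     (\<forall>us vs. Vector_Spaces.linear sX (*) (\<lambda>x. \<omega> (us @ x # vs))) \<and>
     (\<forall>us x vs. \<omega> (us @ x # x # vs) = 0)"

definition wedge :: "('k::field \<Rightarrow> 'x::ab_group_add \<Rightarrow> 'x) \<Rightarrow> 'x list \<Rightarrow> ('x list \<Rightarrow> 'k) \<Rightarrow> 'k" where
  "wedge sX xs = (\<lambda>\<omega>. if alt_form sX \<omega> then \<omega> xs else 0)"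

definition ext_power :: "('k::field \<Rightarrow> 'x::ab_group_add \<Rightarrow> 'x) \<Rightarrow> nat \<Rightarrow> (('x list \<Rightarrow> 'k) \<Rightarrow> 'k) set" where
  "ext_power sX n = module.span fun_scale {wedge sX xs | xs. length xs = n}"

definition ext_mult :: "('k::field \<Rightarrow> 'x::ab_group_add \<Rightarrow> 'x) \<Rightarrow>
    (('x list \<Rightarrow> 'k) \<Rightarrow> 'k) \<Rightarrow> (('x list \<Rightarrow> 'k) \<Rightarrow> 'k) \<Rightarrow> ('x list \<Rightarrow> 'k) \<Rightarrow> 'k" where
  "ext_mult sX u v = (\<lambda>\<omega>. if alt_form sX \<omega> then u (\<lambda>xs. v (\<lambda>ys. \<omega> (xs @ ys))) else 0)"

lemma ext_mult_wedge: "ext_mult sX (wedge sX xs) (wedge sX ys) = wedge sX (xs @ ys)"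
proof
  fix \<omega> :: "'a list \<Rightarrow> 'b"
  show "ext_mult sX (wedge sX xs) (wedge sX ys) \<omega> = wedge sX (xs @ ys) \<omega>"
  proof (cases "alt_form sX \<omega>")
    case True
    have l: "alt_form sX (\<lambda>v. \<omega> (u @ v))" for u
      using True unfolding alt_form_def by (simp flip: append_assoc)
    have r: "alt_form sX (\<lambda>u. \<omega> (u @ v))" for v
      using True unfolding alt_form_def by simp
    show ?thesis using True by (simp add: ext_mult_def wedge_def l r)
  qed (simp add: ext_mult_def wedge_def)
qed

lemma wedge_repeated: "wedge sX (us @ x # x # vs) = 0"
  by (rule ext) (simp add: wedge_def alt_form_def)

text \<open>Value of \<open>u\<close> at the alternating form of degree 0 with value 1, i.e. the \<open>\<and>\<^sup>0\<close>-component of \<open>u\<close>.\<close>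

definition ext_augmentation :: "(('x list \<Rightarrow> 'k::field) \<Rightarrow> 'k) \<Rightarrow> 'k" where
  "ext_augmentation u = u (\<lambda>xs. if xs = [] then 1 else 0)"

definition ExtAlg :: "('k::field \<Rightarrow> 'x::ab_group_add \<Rightarrow> 'x) \<Rightarrow> ('k, ('x list \<Rightarrow> 'k) \<Rightarrow> 'k) bigraded" where
  "ExtAlg sX = \<lparr> smul = fun_scale,
     comp = (\<lambda>i j. if i \<ge> 0 \<and> j = - i then ext_power sX (nat i) else {0}) \<rparr>"

definition ExtAlg_taylor :: "('k::field \<Rightarrow> 'x::ab_group_add \<Rightarrow> 'x) \<Rightarrow>
    (('x list \<Rightarrow> 'k) \<Rightarrow> 'k) list \<Rightarrow> (('x list \<Rightarrow> 'k) \<Rightarrow> 'k)" where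
  "ExtAlg_taylor sX = assoc_taylor (ExtAlg sX) (ext_mult sX)"

definition KK :: "('k::field, 'k) bigraded" where
  "KK = \<lparr> smul = (*), comp = (\<lambda>i j. if i = 0 \<and> j = 0 then UNIV else {0}) \<rparr>"

text \<open>
  The Calaque--Felder--Ferrario--Rossi structure (branes \<open>U = X\<close>, \<open>V = {0}\<close>) enters only through these
  properties, not through the Feynman-graph formula for its Taylor components. Evaluation at \<open>0 \<in> X\<close> is the augmentation of \<open>S(X\<^sup>*)\<close>.
\<close>

definition cffr_bimodule :: "('k::field \<Rightarrow> 'x::ab_group_add \<Rightarrow> 'x) \<Rightarrow>
    (('x \<Rightarrow> 'k) list \<times> 'k \<times> (('x list \<Rightarrow> 'k) \<Rightarrow> 'k) list \<Rightarrow> 'k) \<Rightarrow> bool" where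
  "cffr_bimodule sX dK \<longleftrightarrow> (let A = SymAlg sX; dA = SymAlg_taylor sX; B = ExtAlg sX; dB = ExtAlg_taylor sX in
     su_ainf_bimodule A dA 1 B dB (wedge sX []) KK dK \<and>
     (\<forall>a\<in>homog A. \<forall>x. dK ([a], x, []) = a 0 * x) \<and>
     (\<forall>as\<in>lists (homog A). \<forall>x. length as \<noteq> 1 \<longrightarrow> dK (as, x, []) = 0) \<and>
     (\<forall>b\<in>homog B. \<forall>x. dK ([], x, [b]) = ext_augmentation b * x) \<and>
     (\<forall>bs\<in>lists (homog B). \<forall>x. length bs \<noteq> 1 \<longrightarrow> dK ([], x, bs) = 0) \<and>
     (\<forall>ps as qs bs.
        list_all2 (\<lambda>p a. a \<in> hom_poly sX p) ps as \<and> list_all2 (\<lambda>q b. b \<in> ext_power sX q) qs bs \<and>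
        dK (as, 1, bs) \<noteq> 0 \<longrightarrow>
        int (sum_list ps) = int (length as) + int (length bs) - 1 \<and>
        int (sum_list qs) = int (length as) + int (length bs) - 1) \<and>
     su_algebra_quasi_iso A dA 1 (EndR B KK) (EndR_taylor B dB KK dK) (EndR_unit B KK)
       (derived_left B KK dK) \<and>
     su_algebra_quasi_iso B dB (wedge sX []) (EndL A KK) (EndL_op_taylor A dA KK dK) (EndL_unit A KK)
       (derived_right A B KK dK))"

end

theory Submission
  imports Defs
begin

text \<open>
  \<open>E = End\<^sub>B(K)\<close> has only unary and binary operations, so the diagonal \<open>E\<close>-\<open>E\<close>-bimodule, pulled back
  along the \<open>A\<^sub>\<infinity>\<close>-morphism \<open>L\<close>, has exactly the stated Taylor components: in each of them at most
  one block \<open>L (a\<^sub>1|\<dots>|a\<^sub>n)\<close> can occur. The Taylor components of the bimodule and morphism equations follow from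
  those of the \<open>A\<^sub>\<infinity>\<close>-relations of \<open>E\<close> in arity at most 3 and of the morphism equation for \<open>L\<close>.

  An element of a tensor space vanishes iff all multilinear functionals vanish on it. Applied to such a
  functional, the square of a codifferential, or the commutator of a bicomodule map with
  codifferentials, collapses to the corresponding Taylor components, because the codifferentials of
  the outer algebras are coderivations anticommuting with the Koszul sign.
\<close>

subsection \<open>Tensor spaces and multilinear functionals\<close>

text \<open>Two features of the setting shape the proof. First, an equation in a tensor space is
  known only modulo the span of the relations. Coming down from it, the multilinear projection
  \<open>letter\<close> onto words of length one kills the relations and leaves an honest equation
  between Taylor components; going back up, all multilinear functionals are tested. Second, a degree
  says nothing at 0, where \<open>cdeg\<close> takes the default value 0, and linearity is available
  only inside one bidegree. Hence sign arguments split off the case of a vanishing value, in which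
  multilinearity kills the term, and a functional is exchanged with a sum only after the terms are
  shown to share a bidegree. The signs of the statement are those of the binary operation of E,
  governed by the degree of its first factor. For the right action this factor is the module
  element. For the left action it is \<open>L (a_1|...|a_n)\<close>, whose degree is the shifted
  degree of the word plus one, and this has the parity of the stated exponent. A component with
  arguments on both sides would be a ternary operation of E.\<close>

lemma lookup_fscal [simp]: "Poly_Mapping.lookup (fscal c p) w = c * Poly_Mapping.lookup p w"
  by (simp add: fscal_def Poly_Mapping.map.rep_eq when_def)

lemma vector_space_fscal: "vector_space (fscal :: 'k::field \<Rightarrow> ('w \<Rightarrow>\<^sub>0 'k) \<Rightarrow> _)"
  by unfold_locales (auto intro!: poly_mapping_eqI simp: lookup_add algebra_simps)

lemma vector_space_mult: "vector_space ((*) :: 'k::field \<Rightarrow> 'k \<Rightarrow> 'k)"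
  by unfold_locales (auto simp: algebra_simps)

lemma keys_fscal: "Poly_Mapping.keys (fscal c p) \<subseteq> Poly_Mapping.keys p"
  by (auto simp: Poly_Mapping.in_keys_iff)

lemma fscal_single: "fscal c (Poly_Mapping.single w r) = Poly_Mapping.single w (c * r)"
  by (rule poly_mapping_eqI) (simp add: lookup_single when_def)

context
  fixes sc :: "'k::field \<Rightarrow> 'v::ab_group_add \<Rightarrow> 'v"
  assumes sc: "vector_space sc"
begin

interpretation vector_space sc by (rule sc)

lemma lin_ext_superset:
  assumes "finite S" "Poly_Mapping.keys p \<subseteq> S"
  shows "lin_ext sc h p = (\<Sum>w\<in>S. sc (Poly_Mapping.lookup p w) (h w))"
  unfolding lin_ext_def using assms
  by (intro sum.mono_neutral_left) (auto simp: Poly_Mapping.in_keys_iff)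

lemma lin_ext_zero [simp]: "lin_ext sc h 0 = 0"
  by (simp add: lin_ext_def)

lemma lin_ext_zero_fun [simp]: "lin_ext sc (\<lambda>w. 0) p = 0"
  by (simp add: lin_ext_def)

lemma lin_ext_single [simp]: "lin_ext sc h (Poly_Mapping.single w c) = sc c (h w)"
  by (simp add: lin_ext_def)

lemma lin_ext_add: "lin_ext sc h (p + q) = lin_ext sc h p + lin_ext sc h q"
proof -
  let ?S = "Poly_Mapping.keys p \<union> Poly_Mapping.keys q"
  have "Poly_Mapping.keys (p + q) \<subseteq> ?S" by (rule Poly_Mapping.keys_add)
  then show ?thesis
    by (simp add: lin_ext_superset[of ?S] lookup_add scale_left_distrib sum.distrib)
qed

lemma lin_ext_fscal: "lin_ext sc h (fscal c p) = sc c (lin_ext sc h p)"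
  using lin_ext_superset[OF finite_keys keys_fscal, where h = h]
  by (simp add: lin_ext_def scale_sum_right)

lemma linear_lin_ext: "Vector_Spaces.linear fscal sc (lin_ext sc h)"
  by (intro Vector_Spaces.linear.intro vector_space_fscal sc module_hom.intro
      vector_space_fscal[unfolded vector_space_def module_def[symmetric]]
      sc[unfolded vector_space_def module_def[symmetric]] module_hom_axioms.intro lin_ext_add lin_ext_fscal)

lemma lin_ext_diff: "lin_ext sc h (p - q) = lin_ext sc h p - lin_ext sc h q"
  using lin_ext_add[of h "p - q" q] by (simp add: algebra_simps)

lemma lin_ext_sum: "lin_ext sc h (\<Sum>i\<in>I. p i) = (\<Sum>i\<in>I. lin_ext sc h (p i))"
  by (induction I rule: infinite_finite_induct) (auto simp: lin_ext_add)

lemma lin_ext_cong: "(\<And>w. w \<in> Poly_Mapping.keys p \<Longrightarrow> h w = h' w) \<Longrightarrow> lin_ext sc h p = lin_ext sc h' p"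
  by (simp add: lin_ext_def)

lemma lin_ext_lin_ext: "lin_ext sc h (lin_ext fscal D p) = lin_ext sc (\<lambda>w. lin_ext sc h (D w)) p"
  unfolding lin_ext_def[of fscal] by (simp add: lin_ext_sum lin_ext_fscal lin_ext_def[of sc _ p])

lemma lin_ext_fun_add: "lin_ext sc (\<lambda>w. h w + h' w) p = lin_ext sc h p + lin_ext sc h' p"
  by (simp add: lin_ext_def scale_right_distrib sum.distrib)

lemma lin_ext_fun_sc: "lin_ext sc (\<lambda>w. sc c (h w)) p = sc c (lin_ext sc h p)"
  by (simp add: lin_ext_def scale_sum_right mult.commute)

end

text \<open>If p lay outside the span, a maximal independent subset of S would stay independent
  after adding p, and a functional could be prescribed as 1 at p and 0 on that subset.\<close>

lemma mem_span_by_functionals: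
  assumes sc: "vector_space (sc :: 'k::field \<Rightarrow> 'v::ab_group_add \<Rightarrow> 'v)"
    and "\<And>f. Vector_Spaces.linear sc (*) f \<Longrightarrow> (\<And>x. x \<in> S \<Longrightarrow> f x = 0) \<Longrightarrow> f p = 0"
  shows "p \<in> module.span sc S"
proof (rule ccontr)
  assume p: "p \<notin> module.span sc S"
  interpret vector_space sc by (rule sc)
  interpret vector_space_pair sc "(*) :: 'k \<Rightarrow> 'k \<Rightarrow> 'k"
    by (intro vector_space_pair.intro sc vector_space_mult)
  obtain C where C: "C \<subseteq> S" "independent C" "span S \<subseteq> span C"
    by (meson maximal_independent_subset span_minimal subspace_span)
  then have pC: "p \<notin> span C" using p span_mono by blast
  then have "independent (insert p C)" using C independent_insertI by blast
  then obtain f where f: "Vector_Spaces.linear sc (*) f" "\<forall>x\<in>insert p C. f x = (if x = p then 1 else 0)"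
    using linear_independent_extend[of _ "\<lambda>x. if x = p then 1 else 0"] by meson
  interpret f: Vector_Spaces.linear sc "(*)" f by (rule f)
  have C0: "f x = 0" if "x \<in> C" for x
    using f(2) that pC span_base by fastforce
  have "f x = 0" if "x \<in> S" for x
    using f.eq_0_on_span[OF C0] C(3) span_base[OF that] by auto
  from assms(2)[OF f(1) this] f(2) show False by simp
qed

lemma functional_eq_lin_ext:
  fixes f :: "('w \<Rightarrow>\<^sub>0 'k::field) \<Rightarrow> 'k"
  assumes "Vector_Spaces.linear fscal (*) f"
  shows "f p = lin_ext (*) (\<lambda>w. f (Poly_Mapping.single w 1)) p"
proof -
  interpret f: Vector_Spaces.linear fscal "(*)" f by (rule assms)
  have "p = (\<Sum>w\<in>Poly_Mapping.keys p. Poly_Mapping.single w (Poly_Mapping.lookup p w))"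
    by (rule poly_mapping_eqI) (auto simp: lookup_sum lookup_single when_def Poly_Mapping.in_keys_iff)
  then have "f p = (\<Sum>w\<in>Poly_Mapping.keys p. f (fscal (Poly_Mapping.lookup p w) (Poly_Mapping.single w 1)))"
    by (simp add: fscal_single flip: f.sum)
  then show ?thesis by (simp add: lin_ext_def f.scale)
qed

text \<open>With \<open>lin_ext_slot_rel\<close> this is the universal property of the tensor space:
  functionals killing the relations correspond to functions on words that are linear in each
  slot.\<close>

lemma hlinear_by_slot_rel:
  assumes "Vector_Spaces.linear fscal (*) f" "\<And>p. p \<in> slot_rel V c \<Longrightarrow> f p = 0"
  shows "hlinear V (*) (\<lambda>x. f (Poly_Mapping.single (c x) 1))"
proof -
  interpret f: Vector_Spaces.linear fscal "(*)" f by (rule assms)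
  show ?thesis
    unfolding hlinear_def
  proof (intro conjI allI ballI)
    fix i j x y assume xy: "x \<in> comp V i j" "y \<in> comp V i j"
    have "Poly_Mapping.single (c (x + y)) 1 - Poly_Mapping.single (c x) 1 - Poly_Mapping.single (c y) 1
        \<in> slot_rel V c"
      unfolding slot_rel_def using xy by blast
    from assms(2)[OF this] show "f (Poly_Mapping.single (c (x + y)) 1) =
        f (Poly_Mapping.single (c x) 1) + f (Poly_Mapping.single (c y) 1)"
      by (simp add: f.diff f.add algebra_simps)
  next
    fix r x assume "x \<in> homog V"
    then have "Poly_Mapping.single (c (smul V r x)) 1 - Poly_Mapping.single (c x) r \<in> slot_rel V c"
      unfolding slot_rel_def by blast
    from assms(2)[OF this] show "f (Poly_Mapping.single (c (smul V r x)) 1) = r * f (Poly_Mapping.single (c x) 1)"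
      using f.scale[of r "Poly_Mapping.single (c x) 1"] by (simp add: f.diff fscal_single)
  qed
qed

lemma lin_ext_slot_rel:
  assumes sc: "vector_space sc" and "hlinear V sc (\<lambda>x. h (c x))" "p \<in> slot_rel V c"
  shows "lin_ext sc h p = 0"
proof -
  interpret vector_space sc by (rule sc)
  show ?thesis using assms(2,3) unfolding slot_rel_def hlinear_def
    by (auto simp: lin_ext_diff[OF sc] lin_ext_single[OF sc])
qed

lemma lin_ext_span:
  assumes sc: "vector_space sc" and "\<And>p. p \<in> S \<Longrightarrow> lin_ext sc h p = 0" "p \<in> module.span fscal S"
  shows "lin_ext sc h p = 0"
proof -
  interpret Vector_Spaces.linear fscal sc "lin_ext sc h" by (rule linear_lin_ext[OF sc])
  show ?thesis using eq_0_on_span assms(2,3) by blast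
qed

lemma lin_ext_rel_T:
  assumes sc: "vector_space sc" and "multilinear_T A sc h" "p \<in> rel_T A"
  shows "lin_ext sc h p = 0"
  by (rule lin_ext_span[OF sc _ assms(3)[unfolded rel_T_def]])
    (use assms(2) in \<open>auto simp: multilinear_T_def intro: lin_ext_slot_rel[OF sc]\<close>)

lemma mem_rel3I:
  assumes "\<And>g. multilinear3 A M B (*) g \<Longrightarrow> lin_ext (*) g p = 0"
  shows "p \<in> rel3 A M B"
  unfolding rel3_def
proof (rule mem_span_by_functionals[OF vector_space_fscal])
  fix f assume f: "Vector_Spaces.linear fscal (*) f"
    and *: "\<And>x. x \<in> (\<Union>c\<in>slots3_left A M B. slot_rel A c) \<union> (\<Union>c\<in>slots3_mid A B. slot_rel M c) \<union>
      (\<Union>c\<in>slots3_right A M B. slot_rel B c) \<Longrightarrow> f x = 0"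
  have "multilinear3 A M B (*) (\<lambda>w. f (Poly_Mapping.single w 1))"
    unfolding multilinear3_def by (intro conjI ballI hlinear_by_slot_rel[OF f] *) auto
  from assms[OF this] show "f p = 0"
    by (simp add: functional_eq_lin_ext[OF f, symmetric])
qed

subsection \<open>Deconcatenation sums and coderivations\<close>

text \<open>The sum over the deconcatenation coproduct in Sweedler style. Structural recursion turns
  coassociativity into an induction, while \<open>decsum_eq_sum\<close> gives the index form in
  which the lifts are defined.\<close>

primrec decsum :: "'a list \<Rightarrow> ('a list \<Rightarrow> 'a list \<Rightarrow> 'v::comm_monoid_add) \<Rightarrow> 'v" where
  "decsum [] h = h [] []"
| "decsum (x # w) h = h [] (x # w) + decsum w (\<lambda>u. h (x # u))"

lemma decsum_eq_sum: "decsum w h = (\<Sum>i\<le>length w. h (take i w) (drop i w))"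
  by (induction w arbitrary: h) (simp_all add: sum.atMost_Suc_shift del: sum.atMost_Suc)

lemma decsum_cong:
  "(\<And>u v. u @ v = w \<Longrightarrow> h u v = h' u v) \<Longrightarrow> decsum w h = decsum w h'"
  by (simp add: decsum_eq_sum)

lemma decsum_add: "decsum w (\<lambda>u v. h u v + h' u v) = decsum w h + decsum w h'"
  by (simp add: decsum_eq_sum sum.distrib)

lemma decsum_diff: "decsum w (\<lambda>u v. h u v - h' u v) = decsum w h - decsum w (h' :: _ \<Rightarrow> _ \<Rightarrow> 'v::ab_group_add)"
  by (simp add: decsum_eq_sum sum_subtractf)

lemma decsum_mult: "decsum w (\<lambda>u v. c * h u v) = c * decsum w (h :: _ \<Rightarrow> _ \<Rightarrow> 'v::semiring_0)"
  by (simp add: decsum_eq_sum sum_distrib_left)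

lemma decsum_zero [simp]: "decsum w (\<lambda>u v. 0) = 0"
  by (simp add: decsum_eq_sum)

lemma decsum_swap: "decsum w (\<lambda>u v. decsum w' (h u v)) = decsum w' (\<lambda>u' v'. decsum w (\<lambda>u v. h u v u' v'))"
  by (simp add: decsum_eq_sum sum.swap[of _ _ "{..length w}"])

text \<open>Both sides run over the splittings of w into three consecutive pieces.\<close>

lemma decsum_coassoc:
  "decsum w (\<lambda>u v. decsum u (\<lambda>a b. h a b v)) = decsum w (\<lambda>u v. decsum v (h u))"
  by (induction w arbitrary: h) (simp_all add: decsum_add add.assoc)

text \<open>A cut falls either before or after the letter y.\<close>

lemma decsum_append_Cons:
  "decsum (u @ y # x) h = decsum u (\<lambda>a b. h a (b @ y # x)) + decsum x (\<lambda>a. h (u @ y # a))"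
  by (induction u arbitrary: h) (simp_all add: add.assoc)

text \<open>For the empty word the two extreme cuts coincide and count once, hence the case
  distinction.\<close>

lemma decsum_ends:
  assumes "\<And>u v. u @ v = w \<Longrightarrow> u \<noteq> [] \<Longrightarrow> v \<noteq> [] \<Longrightarrow> h u v = 0"
  shows "decsum w h = (if w = [] then h [] [] else h [] w + h w [])"
  using assms
proof (induction w arbitrary: h)
  case (Cons x w)
  have "decsum w (\<lambda>u. h (x # u)) = h (x # w) []"
  proof (cases "w = []")
    case False
    then have "h [x] w = 0" using Cons.prems[of "[x]" w] by simp
    with False show ?thesis using Cons.IH[of "\<lambda>u. h (x # u)"] Cons.prems by simp
  qed simp
  then show ?case by simp
qed simp

text \<open>The Koszul sign of an odd operator passing the word w. As a field element it obeys
  multiplicative rules, which keeps integer exponents out of the later computations.\<close>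

definition weps :: "('k::field, 'a::ab_group_add) bigraded \<Rightarrow> 'a list \<Rightarrow> 'k" where
  "weps V w = (-1) powi sdeg V w"

lemma sdeg_simps [simp]: "sdeg V [] = 0" "sdeg V (x # w) = cdeg V x - 1 + sdeg V w"
  "sdeg V (u @ v) = sdeg V u + sdeg V v"
  by (simp_all add: sdeg_def)

lemma weps_Nil [simp]: "weps V [] = 1"
  and weps_append: "weps V (u @ v) = weps V u * weps V v"
  and weps_Cons: "weps V (x # v) = (-1) powi (cdeg V x - 1) * weps V v"
  by (simp_all add: weps_def power_int_add)

lemma powi_minus_one_sq [simp]: "(-1 :: 'k::field) powi a * (-1) powi a = 1"
  by (simp flip: power_int_mult_distrib)

lemma weps_sq [simp]: "weps V u * weps V u = 1" "weps V u * (weps V u * c) = c"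
  by (simp_all add: weps_def flip: mult.assoc)

text \<open>The pieces are the untouched prefix u, the block v fed to d and the suffix x. The guard
  on v reflects the lower bound 1 on the block length in \<open>coder\<close>.\<close>

lemma lin_ext_coder:
  assumes sc: "vector_space sc"
  shows "lin_ext sc h (coder V d w) =
    decsum w (\<lambda>u y. decsum y (\<lambda>v x. if v = [] then 0 else sc (weps V u) (h (u @ d v # x))))"
proof -
  have "(\<Sum>n\<in>{1..length w - i}. sc (weps V (take i w)) (h (take i w @ d (take n (drop i w)) # drop (i + n) w)))
     = (\<Sum>n\<le>length w - i. if take n (drop i w) = [] then 0 else
          sc (weps V (take i w)) (h (take i w @ d (take n (drop i w)) # drop n (drop i w))))" for i
    by (rule sum.mono_neutral_cong_left) (auto simp: add.commute)
  then show ?thesis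
    by (simp add: coder_def decsum_eq_sum lin_ext_sum[OF sc] lin_ext_single[OF sc] weps_def)
qed

lemma coder_Nil: "coder V d [] = 0"
  by (simp add: coder_def)

text \<open>\<open>coder V d\<close> is a coderivation with respect to deconcatenation.\<close>

lemma lin_ext_coder_decsum:
  "lin_ext (*) (\<lambda>a. decsum a H) (coder V d w) =
     decsum w (\<lambda>u v. lin_ext (*) (\<lambda>a. H a v) (coder V d u) + weps V u * lin_ext (*) (H u) (coder V d v))"
proof -
  have "lin_ext (*) (\<lambda>a. decsum a H) (coder V d w) =
      decsum w (\<lambda>u y. decsum y (\<lambda>v x. decsum u (\<lambda>a b. if v = [] then 0 else weps V u * H a (b @ d v # x))
        + decsum x (\<lambda>a b. if v = [] then 0 else weps V u * H (u @ d v # a) b)))"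
    unfolding lin_ext_coder[OF vector_space_mult]
    by (intro decsum_cong) (simp add: decsum_append_Cons distrib_left decsum_mult)
  also have "\<dots> = decsum w (\<lambda>u y. decsum y (\<lambda>v x. decsum u (\<lambda>a b. if v = [] then 0 else weps V u * H a (b @ d v # x))))
       + decsum w (\<lambda>u y. decsum y (\<lambda>v x. decsum x (\<lambda>a b. if v = [] then 0 else weps V u * H (u @ d v # a) b)))"
    by (simp add: decsum_add)
  also have "decsum w (\<lambda>u y. decsum y (\<lambda>v x. decsum u (\<lambda>a b. if v = [] then 0 else weps V u * H a (b @ d v # x))))
      = decsum w (\<lambda>u y. decsum u (\<lambda>a b. decsum y (\<lambda>v x. if v = [] then 0 else weps V (a @ b) * H a (b @ d v # x))))"
    by (subst decsum_swap) (intro decsum_cong, auto)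
  also have "\<dots> = decsum w (\<lambda>a z. decsum z (\<lambda>b y. decsum y (\<lambda>v x. if v = [] then 0 else weps V (a @ b) * H a (b @ d v # x))))"
    by (rule decsum_coassoc)
  also have "\<dots> = decsum w (\<lambda>u v. weps V u * lin_ext (*) (H u) (coder V d v))"
    unfolding lin_ext_coder[OF vector_space_mult] decsum_mult[symmetric]
    by (intro decsum_cong) (auto simp: weps_append)
  also have "decsum w (\<lambda>u y. decsum y (\<lambda>v x. decsum x (\<lambda>a b. if v = [] then 0 else weps V u * H (u @ d v # a) b)))
      = decsum w (\<lambda>u y. decsum y (\<lambda>z b. decsum z (\<lambda>v a. if v = [] then 0 else weps V u * H (u @ d v # a) b)))"
    by (simp only: decsum_coassoc)
  also have "\<dots> = decsum w (\<lambda>z b. decsum z (\<lambda>u z. decsum z (\<lambda>v a. if v = [] then 0 else weps V u * H (u @ d v # a) b)))"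
    by (rule decsum_coassoc[symmetric])
  also have "\<dots> = decsum w (\<lambda>u v. lin_ext (*) (\<lambda>a. H a v) (coder V d u))"
    by (simp only: lin_ext_coder[OF vector_space_mult])
  finally show ?thesis by (simp add: decsum_add add.commute)
qed

lemma lin_ext_decsum:
  "lin_ext (*) (\<lambda>a. decsum w (h a)) p = decsum w (\<lambda>u v. lin_ext (*) (\<lambda>a. h a u v) p)"
  by (simp add: lin_ext_def decsum_eq_sum sum_distrib_left sum.swap[of _ _ "{..length w}"])

subsection \<open>Degrees and multilinear maps\<close>

lemma bigraded_spaceD:
  assumes "bigraded_space V"
  shows "vector_space (smul V)" "module.subspace (smul V) (comp V i j)"
  using assms by (auto simp: bigraded_space_def)

lemma bigraded_zero_mem:
  assumes "bigraded_space V"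
  shows "0 \<in> comp V i j" "0 \<in> homog V"
proof -
  interpret vector_space "smul V" using assms by (rule bigraded_spaceD)
  show "0 \<in> comp V i j" using subspace_0 bigraded_spaceD(2)[OF assms] by blast
  then show "0 \<in> homog V"
    using subspace_0 bigraded_spaceD(2)[OF assms] by (auto simp: homog_def)
qed

lemma homogI [intro]: "x \<in> comp V i j \<Longrightarrow> x \<in> homog V"
  by (auto simp: homog_def)

lemma bigraded_comp_unique:
  assumes V: "bigraded_space V" and x: "x \<in> comp V i j" "x \<in> comp V i' j'" "x \<noteq> 0"
  shows "(i, j) = (i', j')"
proof (rule ccontr)
  assume ne: "(i, j) \<noteq> (i', j')"
  interpret vector_space "smul V" using V by (rule bigraded_spaceD)
  \<comment> \<open>The vectors x and -x placed in two distinct bidegrees sum to 0, against the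
    independence of the components.\<close>
  define y where "y = (\<lambda>p. if p = (i, j) then x else - x)"
  have "- x \<in> comp V i' j'"
    using subspace_neg[OF bigraded_spaceD(2)[OF V] x(2)] .
  then have "(\<forall>p\<in>{(i, j), (i', j')}. y p \<in> comp V (fst p) (snd p)) \<and> (\<Sum>p\<in>{(i, j), (i', j')}. y p) = 0"
    using x ne by (auto simp: y_def)
  with V have "\<forall>p\<in>{(i, j), (i', j')}. y p = 0"
    unfolding bigraded_space_def by (metis (no_types, lifting) finite.emptyI finite.insertI)
  with x show False by (simp add: y_def)
qed

lemma cdeg_eq:
  assumes V: "bigraded_space V" and x: "x \<in> comp V i j" "x \<noteq> 0"
  shows "cdeg V x = i"
proof -
  have "(THE i. \<exists>j. x \<in> comp V i j) = i"
    by (intro the_equality) (use x(1) bigraded_comp_unique[OF V _ x] in blast)+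
  with x show ?thesis by (simp add: cdeg_def)
qed

lemma has_degs_Nil [simp]: "has_degs V ds [] \<longleftrightarrow> ds = []"
  by (simp add: has_degs_def)

lemma has_degs_Cons [simp]:
  "has_degs V ds (x # w) \<longleftrightarrow> (\<exists>i j es. ds = (i, j) # es \<and> x \<in> comp V i j \<and> has_degs V es w)"
  by (cases ds) (auto simp: has_degs_def)

lemma has_degs_append:
  "has_degs V ds (u @ v) \<longleftrightarrow> (\<exists>es fs. ds = es @ fs \<and> has_degs V es u \<and> has_degs V fs v)"
  by (auto simp: has_degs_def list_all2_append2 intro: list_all2_appendI dest: list_all2_lengthD)

lemma has_degs_appendI: "has_degs V es u \<Longrightarrow> has_degs V fs v \<Longrightarrow> has_degs V (es @ fs) (u @ v)"
  by (auto simp: has_degs_append)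

lemma wdeg_simps [simp]: "wdeg [] = 0" "wdeg (d # ds) = fst d - 1 + wdeg ds" "wdeg (ds @ es) = wdeg ds + wdeg es"
  and wint_simps [simp]: "wint [] = 0" "wint (d # ds) = snd d + wint ds" "wint (ds @ es) = wint ds + wint es"
  by (simp_all add: wdeg_def wint_def)

lemma has_degs_homog: "has_degs V ds w \<Longrightarrow> w \<in> lists (homog V)"
  by (induction w arbitrary: ds) auto

lemma has_degs_exists: "w \<in> lists (homog V) \<Longrightarrow> \<exists>ds. has_degs V ds w"
proof (induction rule: lists.induct)
  case (Cons x w)
  then obtain i j ds where "x \<in> comp V i j" "has_degs V ds w" unfolding homog_def by blast
  then have "has_degs V ((i, j) # ds) (x # w)" by simp
  then show ?case by blast
qed simp

lemma sdeg_eq_wdeg: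
  assumes "bigraded_space V" "has_degs V ds w" "0 \<notin> set w"
  shows "sdeg V w = wdeg ds"
  using assms(2,3) by (induction w arbitrary: ds) (auto simp: cdeg_eq[OF assms(1)])

section \<open>Maps linear on homogeneous elements\<close>

lemma hlinear_zero:
  assumes "bigraded_space V" "vector_space sc" "hlinear V sc g"
  shows "g 0 = 0"
proof -
  interpret V: vector_space "smul V" using assms(1) by (rule bigraded_spaceD)
  interpret sc: vector_space sc by (rule assms(2))
  have "g (smul V 0 0) = sc 0 (g 0)"
    using assms(3) bigraded_zero_mem[OF assms(1)] unfolding hlinear_def by blast
  then show ?thesis by simp
qed

text \<open>Since \<open>hlinear\<close> gives additivity only inside one component, all values of h
  must share the bidegree (i, j). The induction carries membership of the partial sums along with
  the identity.\<close>

lemma hlinear_lin_ext: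
  assumes V: "bigraded_space V" and sc: "vector_space sc" and g: "hlinear V sc g"
    and h: "\<And>w. w \<in> Poly_Mapping.keys p \<Longrightarrow> h w \<in> comp V i j"
  shows "g (lin_ext (smul V) h p) = lin_ext sc (\<lambda>w. g (h w)) p"
proof -
  interpret V: vector_space "smul V" using V by (rule bigraded_spaceD)
  have *: "(\<Sum>w\<in>S. smul V (c w) (h w)) \<in> comp V i j \<and>
      g (\<Sum>w\<in>S. smul V (c w) (h w)) = (\<Sum>w\<in>S. sc (c w) (g (h w)))"
    if "finite S" "S \<subseteq> Poly_Mapping.keys p" for S c
    using that
  proof (induction S rule: finite_induct)
    case empty
    show ?case using hlinear_zero[OF V sc g] bigraded_zero_mem[OF V] by simp
  next
    case (insert x S)
    have x: "h x \<in> comp V i j" using h insert.prems by auto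
    have cx: "smul V (c x) (h x) \<in> comp V i j"
      using V.subspace_scale[OF bigraded_spaceD(2)[OF V] x] .
    have "g (smul V (c x) (h x)) = sc (c x) (g (h x))"
      using g x unfolding hlinear_def by blast
    then show ?case
      using insert cx g V.subspace_add[OF bigraded_spaceD(2)[OF V] cx]
      by (auto simp: hlinear_def)
  qed
  show ?thesis unfolding lin_ext_def using *[OF finite_keys] by blast
qed

lemma multilinear_T_slot:
  assumes "multilinear_T A sc f" "us \<in> lists (homog A)" "vs \<in> lists (homog A)"
  shows "hlinear A sc (\<lambda>x. f (us @ x # vs))"
  using assms unfolding multilinear_T_def slots_T_def by fastforce

lemma multilinear_TI:
  assumes "\<And>us vs. us \<in> lists (homog A) \<Longrightarrow> vs \<in> lists (homog A) \<Longrightarrow> hlinear A sc (\<lambda>x. f (us @ x # vs))"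
  shows "multilinear_T A sc f"
  using assms unfolding multilinear_T_def slots_T_def by fastforce

lemma multilinear_T_zero:
  assumes "bigraded_space A" "vector_space sc" "multilinear_T A sc f" "w \<in> lists (homog A)" "0 \<in> set w"
  shows "f w = 0"
proof -
  obtain us vs where w: "w = us @ 0 # vs" using assms(5) by (meson split_list)
  show ?thesis unfolding w
    by (rule hlinear_zero[OF assms(1,2) multilinear_T_slot[OF assms(3)]]) (use assms(4) w in auto)
qed

lemma multilinear3_left:
  assumes "multilinear3 A M B sc g" "m \<in> homog M" "bs \<in> lists (homog B)"
  shows "multilinear_T A sc (\<lambda>a. g (a, m, bs))"
  unfolding multilinear_T_def
proof
  fix c assume "c \<in> slots_T A"
  then have c: "(\<lambda>x. (c x, m, bs)) \<in> slots3_left A M B" unfolding slots3_left_def using assms by blast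
  have "\<forall>c\<in>slots3_left A M B. hlinear A sc (\<lambda>x. g (c x))"
    using assms(1) by (simp add: multilinear3_def)
  from bspec[OF this c] show "hlinear A sc (\<lambda>x. g (c x, m, bs))" .
qed

lemma multilinear3_mid:
  assumes "multilinear3 A M B sc g" "as \<in> lists (homog A)" "bs \<in> lists (homog B)"
  shows "hlinear M sc (\<lambda>m. g (as, m, bs))"
proof -
  have c: "(\<lambda>x. (as, x, bs)) \<in> slots3_mid A B" unfolding slots3_mid_def using assms by blast
  have "\<forall>c\<in>slots3_mid A B. hlinear M sc (\<lambda>x. g (c x))"
    using assms(1) by (simp add: multilinear3_def)
  from bspec[OF this c] show ?thesis .
qed

lemma multilinear3_right:
  assumes "multilinear3 A M B sc g" "as \<in> lists (homog A)" "m \<in> homog M"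
  shows "multilinear_T B sc (\<lambda>b. g (as, m, b))"
  unfolding multilinear_T_def
proof
  fix c assume "c \<in> slots_T B"
  then have c: "(\<lambda>x. (as, m, c x)) \<in> slots3_right A M B" unfolding slots3_right_def using assms by blast
  have "\<forall>c\<in>slots3_right A M B. hlinear B sc (\<lambda>x. g (c x))"
    using assms(1) by (simp add: multilinear3_def)
  from bspec[OF this c] show "hlinear B sc (\<lambda>x. g (as, m, c x))" .
qed

lemma multilinear3I:
  fixes M :: "('k, 'm::ab_group_add) bigraded" and g :: "'a::ab_group_add list \<times> 'm \<times> 'b::ab_group_add list \<Rightarrow> 'v::ab_group_add"
  assumes "\<And>m bs. m \<in> homog M \<Longrightarrow> bs \<in> lists (homog B) \<Longrightarrow> multilinear_T A sc (\<lambda>a. g (a, m, bs))"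
    and "\<And>as bs. as \<in> lists (homog A) \<Longrightarrow> bs \<in> lists (homog B) \<Longrightarrow> hlinear M sc (\<lambda>m. g (as, m, bs))"
    and "\<And>as m. as \<in> lists (homog A) \<Longrightarrow> m \<in> homog M \<Longrightarrow> multilinear_T B sc (\<lambda>b. g (as, m, b))"
  shows "multilinear3 A M B sc g"
  unfolding multilinear3_def
proof (intro conjI ballI)
  fix c assume "c \<in> slots3_left A M B"
  then obtain c' m bs where "c = (\<lambda>x. (c' x, m, bs))" "c' \<in> slots_T A" "m \<in> homog M" "bs \<in> lists (homog B)"
    unfolding slots3_left_def by blast
  then show "hlinear A sc (\<lambda>x. g (c x))" using assms(1)[of m bs] by (simp add: multilinear_T_def)
next
  fix c :: "'m \<Rightarrow> 'a list \<times> 'm \<times> 'b list" assume "c \<in> slots3_mid A B"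
  then obtain as bs where "c = (\<lambda>x. (as, x, bs))" "as \<in> lists (homog A)" "bs \<in> lists (homog B)"
    unfolding slots3_mid_def by blast
  then show "hlinear M sc (\<lambda>x. g (c x))" using assms(2)[of as bs] by simp
next
  fix c assume "c \<in> slots3_right A M B"
  then obtain c' m as where "c = (\<lambda>x. (as, m, c' x))" "c' \<in> slots_T B" "m \<in> homog M" "as \<in> lists (homog A)"
    unfolding slots3_right_def by blast
  then show "hlinear B sc (\<lambda>x. g (c x))" using assms(3)[of as m] by (simp add: multilinear_T_def)
qed

text \<open>The output degree is taken in W, one above its degree in W[1]. Thus e = 2 for the
  components of a codifferential and e = 1 for those of a coalgebra morphism.\<close>

definition taylor_T where
  "taylor_T V W e f \<longleftrightarrow> multilinear_T V (smul W) f \<and>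
     (\<forall>ds w. w \<noteq> [] \<and> has_degs V ds w \<longrightarrow> f w \<in> comp W (wdeg ds + e) (wint ds))"

text \<open>The module letter enters and leaves unshifted, so e is the degree of the operator
  itself: 1 for a codifferential, 0 for a morphism. It is a natural number because it also serves as
  the exponent of signs.\<close>

definition taylor3 where
  "taylor3 A M B N e P \<longleftrightarrow> multilinear3 A M B (smul N) P \<and>
     (\<forall>ds as i j m es bs. has_degs A ds as \<and> m \<in> comp M i j \<and> has_degs B es bs \<longrightarrow>
        P (as, m, bs) \<in> comp N (wdeg ds + i + wdeg es + int e) (wint ds + j + wint es))"

lemma taylor_T_homog:
  assumes "taylor_T V W e f" "w \<noteq> []" "w \<in> lists (homog V)"
  shows "f w \<in> homog W"
  using assms has_degs_exists[OF assms(3)] unfolding taylor_T_def by blast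

lemma taylor3_homog:
  assumes "taylor3 A M B N e P" "as \<in> lists (homog A)" "m \<in> homog M" "bs \<in> lists (homog B)"
  shows "P (as, m, bs) \<in> homog N"
proof -
  obtain i j where "m \<in> comp M i j" using assms(3) by (auto simp: homog_def)
  then show ?thesis
    using assms(1) has_degs_exists[OF assms(2)] has_degs_exists[OF assms(4)] unfolding taylor3_def by blast
qed

text \<open>A nonzero value is required because \<open>cdeg\<close> has a default at 0. By
  multilinearity it also excludes zero letters, so that \<open>sdeg\<close> agrees with the declared
  degrees.\<close>

lemma cdeg_taylor_T:
  assumes V: "bigraded_space V" and W: "bigraded_space W" and f: "taylor_T V W e f"
    and w: "w \<noteq> []" "w \<in> lists (homog V)" "f w \<noteq> 0"
  shows "cdeg W (f w) = sdeg V w + e"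
proof -
  obtain ds where ds: "has_degs V ds w" using has_degs_exists[OF w(2)] by blast
  have "0 \<notin> set w"
    using multilinear_T_zero[OF V bigraded_spaceD(1)[OF W] _ w(2)] f w(3) by (auto simp: taylor_T_def)
  with ds V have sdeg: "sdeg V w = wdeg ds" by (simp add: sdeg_eq_wdeg)
  have "f w \<in> comp W (wdeg ds + e) (wint ds)"
    using f ds w unfolding taylor_T_def by blast
  from cdeg_eq[OF W this w(3)] show ?thesis by (simp only: sdeg)
qed

lemma cdeg_taylor3:
  assumes A: "bigraded_space A" and M: "bigraded_space M" and B: "bigraded_space B" and N: "bigraded_space N"
    and P: "taylor3 A M B N e P"
    and w: "as \<in> lists (homog A)" "m \<in> homog M" "bs \<in> lists (homog B)" "P (as, m, bs) \<noteq> 0"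
  shows "cdeg N (P (as, m, bs)) = sdeg A as + cdeg M m + sdeg B bs + int e"
proof -
  note sc = bigraded_spaceD(1)[OF N]
  have P3: "multilinear3 A M B (smul N) P" using P by (simp add: taylor3_def)
  obtain ds es i j where ds: "has_degs A ds as" "has_degs B es bs" "m \<in> comp M i j"
    using has_degs_exists[OF w(1)] has_degs_exists[OF w(3)] w(2) by (auto simp: homog_def)
  have "0 \<notin> set as"
    using multilinear_T_zero[OF A sc multilinear3_left[OF P3 w(2,3)] w(1)] w(4) by auto
  then have 1: "sdeg A as = wdeg ds" using A ds by (simp add: sdeg_eq_wdeg)
  have "0 \<notin> set bs"
    using multilinear_T_zero[OF B sc multilinear3_right[OF P3 w(1,2)] w(3)] w(4) by auto
  then have 2: "sdeg B bs = wdeg es" using B ds by (simp add: sdeg_eq_wdeg)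
  have "m \<noteq> 0"
    using hlinear_zero[OF M sc multilinear3_mid[OF P3 w(1,3)]] w(4) by auto
  then have 3: "cdeg M m = i" using cdeg_eq[OF M ds(3)] by simp
  have "P (as, m, bs) \<in> comp N (wdeg ds + i + wdeg es + int e) (wint ds + j + wint es)"
    using P ds unfolding taylor3_def by blast
  from cdeg_eq[OF N this w(4)] show ?thesis by (simp only: 1 2 3)
qed

text \<open>The operation is odd: \<open>d v\<close> has shifted degree one above that of v.\<close>

lemma weps_coder_term:
  fixes V :: "('k::field, 'a::ab_group_add) bigraded"
  assumes V: "bigraded_space V" and d: "taylor_T V V 2 d"
    and w: "u @ v @ x \<in> lists (homog V)" "v \<noteq> []" "d v \<noteq> 0"
  shows "weps V (u @ d v # x) = - weps V (u @ v @ x)"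
proof -
  have "cdeg V (d v) = sdeg V v + 2" using cdeg_taylor_T[OF V V d] w by simp
  then have "(-1 :: 'k) powi (cdeg V (d v) - 1) = - weps V v"
    by (simp add: weps_def power_int_add)
  then show ?thesis by (simp add: weps_append weps_Cons)
qed

lemma lin_ext_coder_cong:
  assumes sc: "vector_space sc"
    and "\<And>u v x. u @ v @ x = w \<Longrightarrow> v \<noteq> [] \<Longrightarrow> h (u @ d v # x) = h' (u @ d v # x)"
  shows "lin_ext sc h (coder V d w) = lin_ext sc h' (coder V d w)"
  unfolding lin_ext_coder[OF sc] by (intro decsum_cong) (auto simp: assms(2))

text \<open>For e = 1 the sign operator anticommutes with the odd coderivation; for e = 0 nothing
  happens. One statement for all e serves both codifferentials and morphisms.\<close>

lemma lin_ext_coder_weps: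
  assumes V: "bigraded_space V" and d: "taylor_T V V 2 d"
    and k: "multilinear_T V (*) k" and w: "w \<in> lists (homog V)"
  shows "lin_ext (*) (\<lambda>a. weps V a ^ e * k a) (coder V d w) =
    (-1) ^ e * weps V w ^ e * lin_ext (*) k (coder V d w)"
proof -
  have "lin_ext (*) (\<lambda>a. weps V a ^ e * k a) (coder V d w) =
      lin_ext (*) (\<lambda>a. ((-1) ^ e * weps V w ^ e) * k a) (coder V d w)"
  proof (rule lin_ext_coder_cong[OF vector_space_mult])
    fix u v x assume uvx: "u @ v @ x = w" "v \<noteq> []"
    show "weps V (u @ d v # x) ^ e * k (u @ d v # x) = ((-1) ^ e * weps V w ^ e) * k (u @ d v # x)"
    \<comment> \<open>If \<open>d v = 0\<close> its degree is the default one and the sign rule may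
      fail, but k vanishes on a word containing the letter 0.\<close>
    proof (cases "d v = 0")
      case True
      then have "k (u @ d v # x) = 0"
        using uvx w bigraded_zero_mem(2)[OF V]
        by (intro multilinear_T_zero[OF V vector_space_mult k]) auto
      then show ?thesis by simp
    next
      case False
      with uvx w show ?thesis by (simp add: weps_coder_term[OF V d] power_minus[of "weps V w"])
    qed
  qed
  then show ?thesis by (simp add: lin_ext_fun_sc[OF vector_space_mult])
qed

subsection \<open>Codifferentials of bimodules\<close>

text \<open>
  For a function \<open>g\<close> on words of \<open>T(A[1]) \<otimes> M[1] \<otimes> T(B[1])\<close>, \<open>opA\<close>, \<open>opP\<close> and \<open>opB\<close> are the
  precompositions of \<open>g\<close> with the summands of a codifferential; \<open>opP A e P\<close> is precomposition with the
  bicomodule lift of the components \<open>P\<close> of degree \<open>e\<close>.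
\<close>

definition opA where
  "opA A dA g = (\<lambda>(as, m, bs). lin_ext (*) (\<lambda>a. g (a, m, bs)) (coder A dA as))"

definition opB where
  "opB A B dB M g = (\<lambda>(as, m, bs).
     weps A as * (-1) powi (cdeg M m - 1) * lin_ext (*) (\<lambda>b. g (as, m, b)) (coder B dB bs))"

definition opP where
  "opP A e P g = (\<lambda>(as, m, bs). decsum as (\<lambda>u v. decsum bs (\<lambda>p q. weps A u ^ e * g (u, P (v, m, p), q))))"

lemma lin_ext_codiff:
  fixes A :: "('k::field, 'a::ab_group_add) bigraded"
  assumes sc: "vector_space sc"
  shows "lin_ext sc h (codiff A dA B dB M dM (as, m, bs)) =
    lin_ext sc (\<lambda>a. h (a, m, bs)) (coder A dA as) +
    decsum as (\<lambda>u v. decsum bs (\<lambda>p q. sc (weps A u) (h (u, dM (v, m, p), q)))) +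
    sc (weps A as * (-1) powi (cdeg M m - 1)) (lin_ext sc (\<lambda>b. h (as, m, b)) (coder B dB bs))"
proof -
  interpret vector_space sc by (rule sc)
  have "(-1 :: 'k) powi (sdeg A as + cdeg M m - 1) = (-1) powi (sdeg A as + (cdeg M m - 1))"
    by (simp add: algebra_simps)
  also have "\<dots> = weps A as * (-1) powi (cdeg M m - 1)"
    by (simp only: weps_def power_int_add neg_equal_0_iff_equal one_neq_zero simp_thms)
  finally show ?thesis
    by (simp add: codiff_def lin_ext_add[OF sc] lin_ext_lin_ext[OF sc] lin_ext_single[OF sc]
        lin_ext_sum[OF sc] lin_ext_fscal[OF sc] decsum_eq_sum weps_def)
qed

lemma lin_ext_mult_codiff:
  "lin_ext (*) g (codiff A dA B dB M dM w) = opA A dA g w + opP A 1 dM g w + opB A B dB M g w"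
  by (cases w) (simp add: lin_ext_codiff[OF vector_space_mult] opA_def opB_def opP_def)

lemma lin_ext_bimod_mor_lift:
  assumes sc: "vector_space sc"
  shows "lin_ext sc h (bimod_mor_lift F (as, m, bs)) =
    decsum as (\<lambda>u v. decsum bs (\<lambda>p q. h (u, F (v, m, p), q)))"
proof -
  interpret vector_space sc by (rule sc)
  show ?thesis
    by (simp add: bimod_mor_lift_def lin_ext_sum[OF sc] lin_ext_single[OF sc] decsum_eq_sum)
qed

lemma lin_ext_mult_bimod_mor_lift: "lin_ext (*) g (bimod_mor_lift F w) = opP A 0 F g w"
  by (cases w) (simp add: lin_ext_bimod_mor_lift[OF vector_space_mult] opP_def)

section \<open>Commutation rules for the summands of a codifferential\<close>

lemma opP_add: "opP A e P (\<lambda>w. g w + h w) w = opP A e P g w + opP A e P h w"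
  by (simp add: opP_def case_prod_beta distrib_left decsum_add)

lemma opA_add: "opA A dA (\<lambda>w. g w + h w) w = opA A dA g w + opA A dA h w"
  by (simp add: opA_def case_prod_beta lin_ext_fun_add[OF vector_space_mult])

lemma opB_add: "opB A B dB M (\<lambda>w. g w + h w) w = opB A B dB M g w + opB A B dB M h w"
  by (simp add: opB_def case_prod_beta distrib_left lin_ext_fun_add[OF vector_space_mult])

text \<open>The coderivation is split along the cut \<open>u @ v\<close>. Acting on u it passes P at
  the cost of \<open>(-1) ^ e\<close>; acting on v it stays among the arguments of P. So the graded
  commutator retains exactly the terms in which P sees the differential of its own
  arguments.\<close>

lemma opA_opP:
  assumes A: "bigraded_space A" and dA: "taylor_T A A 2 dA" and as: "as \<in> lists (homog A)"
    and g: "\<And>u v p q. u @ v = as \<Longrightarrow> p @ q = bs \<Longrightarrow> multilinear_T A (*) (\<lambda>a. g (a, P (v, m, p), q))"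
  shows "opA A dA (opP A e P g) (as, m, bs) = (-1) ^ e * opP A e P (opA A dA g) (as, m, bs) +
    decsum as (\<lambda>u v. decsum bs (\<lambda>p q. weps A u ^ (e + 1) * opA A dA (\<lambda>w. g (u, P w, q)) (v, m, p)))"
proof -
  define H where "H u v = decsum bs (\<lambda>p q. weps A u ^ e * g (u, P (v, m, p), q))" for u v
  have "lin_ext (*) (\<lambda>a. H a v) (coder A dA u) =
      (-1) ^ e * decsum bs (\<lambda>p q. weps A u ^ e * opA A dA g (u, P (v, m, p), q))" if "u @ v = as" for u v
  proof -
    have "u \<in> lists (homog A)" using as that by auto
    from lin_ext_coder_weps[OF A dA g this, OF that]
    show ?thesis
      unfolding H_def lin_ext_decsum decsum_mult[symmetric]
      by (intro decsum_cong) (simp add: opA_def mult.assoc)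
  qed
  moreover have "weps A u * lin_ext (*) (H u) (coder A dA v) =
      decsum bs (\<lambda>p q. weps A u ^ (e + 1) * opA A dA (\<lambda>w. g (u, P w, q)) (v, m, p))" for u v
    unfolding H_def lin_ext_decsum decsum_mult[symmetric]
    by (simp add: opA_def lin_ext_fun_sc[OF vector_space_mult] mult.assoc)
  ultimately have "decsum as (\<lambda>u v. lin_ext (*) (\<lambda>a. H a v) (coder A dA u) + weps A u * lin_ext (*) (H u) (coder A dA v))
    = decsum as (\<lambda>u v. (-1) ^ e * decsum bs (\<lambda>p q. weps A u ^ e * opA A dA g (u, P (v, m, p), q)) +
       decsum bs (\<lambda>p q. weps A u ^ (e + 1) * opA A dA (\<lambda>w. g (u, P w, q)) (v, m, p)))"
    by (intro decsum_cong) simp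
  moreover have "opA A dA (opP A e P g) (as, m, bs) = lin_ext (*) (\<lambda>a. decsum a H) (coder A dA as)"
    by (simp add: opA_def opP_def H_def[abs_def])
  ultimately show ?thesis
    by (simp add: lin_ext_coder_decsum decsum_add decsum_mult opP_def)
qed

text \<open>The mirror image of \<open>opA_opP\<close>, except that the sign in \<open>opB\<close>
  depends on the middle letter. P changes the degree of that letter by e and by the degrees of the
  absorbed words v and p, which is what makes the signs fit.\<close>

lemma opB_opP:
  fixes A :: "('k::field, 'a::ab_group_add) bigraded"
  assumes A: "bigraded_space A" and M: "bigraded_space M" and B: "bigraded_space B" and N: "bigraded_space N"
    and P: "taylor3 A M B N e P"
    and w: "as \<in> lists (homog A)" "m \<in> homog M" "bs \<in> lists (homog B)"
    and g: "\<And>u b. u \<in> lists (homog A) \<Longrightarrow> b \<in> lists (homog B) \<Longrightarrow> g (u, 0, b) = 0"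
    and dB: "taylor_T B B 2 dB"
  shows "opB A B dB M (opP A e P g) (as, m, bs) = (-1) ^ e * opP A e P (opB A B dB N g) (as, m, bs) +
    decsum as (\<lambda>u v. decsum bs (\<lambda>p q. weps A u ^ (e + 1) * opB A B dB M (\<lambda>w. g (u, P w, q)) (v, m, p)))"
proof -
  let ?em = "(-1) powi (cdeg M m - 1)"
  have "opB A B dB M (opP A e P g) (as, m, bs) = decsum as (\<lambda>u v. weps A as * ?em * weps A u ^ e *
      lin_ext (*) (\<lambda>b. decsum b (\<lambda>p q. g (u, P (v, m, p), q))) (coder B dB bs))"
    by (simp add: opB_def opP_def lin_ext_decsum decsum_mult lin_ext_fun_sc[OF vector_space_mult] mult.assoc)
  also have "\<dots> = decsum as (\<lambda>u v. decsum bs (\<lambda>p q.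
      weps A as * ?em * weps A u ^ e * lin_ext (*) (\<lambda>b. g (u, P (v, m, b), q)) (coder B dB p) +
      weps A as * ?em * weps A u ^ e * weps B p * lin_ext (*) (\<lambda>b. g (u, P (v, m, p), b)) (coder B dB q)))"
    by (simp add: lin_ext_coder_decsum distrib_left flip: decsum_mult mult.assoc)
  also have "\<dots> = decsum as (\<lambda>u v. decsum bs (\<lambda>p q.
      weps A u ^ (e + 1) * opB A B dB M (\<lambda>w. g (u, P w, q)) (v, m, p) +
      (-1) ^ e * (weps A u ^ e * opB A B dB N g (u, P (v, m, p), q))))"
  proof (intro decsum_cong arg_cong2[of _ _ _ _ "(+)"])
    fix u v p q assume uv: "u @ v = as" and pq: "p @ q = bs"
    show "weps A as * ?em * weps A u ^ e * lin_ext (*) (\<lambda>b. g (u, P (v, m, b), q)) (coder B dB p) =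
        weps A u ^ (e + 1) * opB A B dB M (\<lambda>w. g (u, P w, q)) (v, m, p)"
      by (simp add: opB_def weps_append flip: uv)
    let ?L = "lin_ext (*) (\<lambda>b. g (u, P (v, m, p), b)) (coder B dB q)"
    show "weps A as * ?em * weps A u ^ e * weps B p * ?L =
        (-1) ^ e * (weps A u ^ e * opB A B dB N g (u, P (v, m, p), q))"
    \<comment> \<open>When the value is 0 its degree gives no sign, but both sides vanish because g
      is 0 on words with middle letter 0.\<close>
    proof (cases "P (v, m, p) = 0")
      case True
      have "?L = lin_ext (*) (\<lambda>b. 0) (coder B dB q)"
      proof (rule lin_ext_coder_cong[OF vector_space_mult])
        fix q1 q2 q3 assume "q1 @ q2 @ q3 = q" "q2 \<noteq> []"
        moreover from this have "dB q2 \<in> homog B"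
          using w pq by (intro taylor_T_homog[OF dB]) auto
        ultimately show "g (u, P (v, m, p), q1 @ dB q2 # q3) = 0"
          unfolding True using w uv pq by (intro g) auto
      qed
      then show ?thesis by (simp add: opB_def lin_ext_zero_fun[OF vector_space_mult])
    next
      case False
      have "cdeg N (P (v, m, p)) = sdeg A v + cdeg M m + sdeg B p + int e"
        using w uv pq False by (intro cdeg_taylor3[OF A M B N P]) auto
      then have "(-1 :: 'k) powi (cdeg N (P (v, m, p)) - 1) =
          (-1) powi (sdeg A v + (cdeg M m - 1) + sdeg B p + int e)" by (simp add: algebra_simps)
      also have "\<dots> = weps A v * ?em * weps B p * (-1) ^ e"
        by (simp add: power_int_add weps_def)
      finally have *: "(-1 :: 'k) powi (cdeg N (P (v, m, p)) - 1) = weps A v * ?em * weps B p * (-1) ^ e" .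
      have "(-1 :: 'k) ^ e * (-1) ^ e = 1" by (simp flip: power_mult_distrib)
      then show ?thesis by (simp add: opB_def * weps_append ac_simps flip: uv)
    qed
  qed
  finally show ?thesis by (simp add: decsum_add decsum_mult opP_def)
qed

text \<open>Both P and Q consume the module letter, so the block of Q always lies inside that of P
  and no terms with disjoint blocks arise. Coassociativity on either side trades the cuts around the
  block of Q for cuts around the block of P.\<close>

lemma opP_opP:
  "opP A e' Q (opP A e P g) (as, m, bs) =
    decsum as (\<lambda>u v. decsum bs (\<lambda>p q. weps A u ^ (e + e') * opP A e' Q (\<lambda>w. g (u, P w, q)) (v, m, p)))"
proof -
  define X where "X a b v p c d =
    weps A a ^ (e + e') * (weps A b ^ e' * g (a, P (b, Q (v, m, p), c), d))" for a b v p c d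
  have "opP A e' Q (opP A e P g) (as, m, bs) =
      decsum as (\<lambda>y v. decsum bs (\<lambda>p q. decsum y (\<lambda>a b. decsum q (\<lambda>c d. X a b v p c d))))"
    unfolding opP_def prod.case decsum_mult[symmetric]
    by (intro decsum_cong) (auto simp: X_def weps_append power_add power_mult_distrib)
  also have "\<dots> = decsum as (\<lambda>y v. decsum y (\<lambda>a b. decsum bs (\<lambda>p q. decsum q (\<lambda>c d. X a b v p c d))))"
    by (intro decsum_cong decsum_swap)
  also have "\<dots> = decsum as (\<lambda>a z. decsum z (\<lambda>b v. decsum bs (\<lambda>p q. decsum q (\<lambda>c d. X a b v p c d))))"
    by (rule decsum_coassoc)
  also have "\<dots> = decsum as (\<lambda>a z. decsum z (\<lambda>b v. decsum bs (\<lambda>q d. decsum q (\<lambda>p c. X a b v p c d))))"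
    by (simp only: decsum_coassoc)
  also have "\<dots> = decsum as (\<lambda>a z. decsum bs (\<lambda>q d. decsum z (\<lambda>b v. decsum q (\<lambda>p c. X a b v p c d))))"
    by (intro decsum_cong decsum_swap)
  also have "\<dots> = decsum as (\<lambda>u v. decsum bs (\<lambda>p q. weps A u ^ (e + e') * opP A e' Q (\<lambda>w. g (u, P w, q)) (v, m, p)))"
    by (simp add: opP_def X_def decsum_mult)
  finally show ?thesis .
qed

section \<open>Bidegrees of the words occurring in codifferentials and lifts\<close>

lemma keys_lin_ext_subset:
  "Poly_Mapping.keys (lin_ext fscal D p) \<subseteq> (\<Union>w\<in>Poly_Mapping.keys p. Poly_Mapping.keys (D w))"
  unfolding lin_ext_def by (rule order.trans[OF Poly_Mapping.keys_sum UN_mono[OF order.refl keys_fscal]])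

lemma keys_single_subset: "Poly_Mapping.keys (Poly_Mapping.single w c) \<subseteq> {w}"
  by simp

lemma keys_coder:
  assumes "a \<in> Poly_Mapping.keys (coder V d w)"
  shows "\<exists>u v x. u @ v @ x = w \<and> v \<noteq> [] \<and> a = u @ d v # x"
proof -
  have "a \<in> (\<Union>i\<le>length w. \<Union>n\<in>{1..length w - i}. {take i w @ d (take n (drop i w)) # drop (i + n) w})"
    using assms unfolding coder_def
    by (rule subsetD[OF order.trans[OF Poly_Mapping.keys_sum UN_mono[OF order.refl
      order.trans[OF Poly_Mapping.keys_sum UN_mono[OF order.refl keys_single_subset]]]], rotated])
  then obtain i n where *: "i \<le> length w" "1 \<le> n" "n \<le> length w - i"
      "a = take i w @ d (take n (drop i w)) # drop (i + n) w"
    by auto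
  have "take i w @ take n (drop i w) @ drop (i + n) w = w"
    by (metis append_take_drop_id add.commute drop_drop)
  moreover have "take n (drop i w) \<noteq> []" using * by auto
  ultimately show ?thesis using *(4) by blast
qed

lemma keys_coder_degs:
  assumes d: "taylor_T V V 2 d" and w: "has_degs V ds w" and a: "a \<in> Poly_Mapping.keys (coder V d w)"
  shows "\<exists>es. has_degs V es a \<and> wdeg es = wdeg ds + 1 \<and> wint es = wint ds"
proof -
  obtain u v x where uvx: "u @ v @ x = w" "v \<noteq> []" "a = u @ d v # x" using keys_coder[OF a] by blast
  then obtain du dv dx where ds: "ds = du @ dv @ dx" "has_degs V du u" "has_degs V dv v" "has_degs V dx x"
    using w by (auto simp: has_degs_append)
  then have "d v \<in> comp V (wdeg dv + 2) (wint dv)"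
    using d uvx(2) unfolding taylor_T_def by blast
  then have "has_degs V (du @ (wdeg dv + 2, wint dv) # dx) a"
    using ds uvx(3) by (simp add: has_degs_appendI)
  then show ?thesis using ds(1) by (intro exI[of _ "du @ (wdeg dv + 2, wint dv) # dx"]) simp
qed

lemma keys_coder_homog:
  assumes "taylor_T V V 2 d" "w \<in> lists (homog V)" "a \<in> Poly_Mapping.keys (coder V d w)"
  shows "a \<in> lists (homog V)"
  using keys_coder_degs[OF assms(1) _ assms(3)] has_degs_exists[OF assms(2)] has_degs_homog by blast

text \<open>Words of a fixed total bidegree, with the middle letter counted unshifted. It records
  that the terms of a codifferential or lift at a homogeneous word share one bidegree, as needed to
  move a functional through their sum.\<close>

definition words3_deg where
  "words3_deg A M B r s = {(as, m, bs). \<exists>ds i j es. has_degs A ds as \<and> m \<in> comp M i j \<and> has_degs B es bs \<and>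
     r = wdeg ds + i + wdeg es \<and> s = wint ds + j + wint es}"

lemma words3_degI:
  "has_degs A ds as \<Longrightarrow> m \<in> comp M i j \<Longrightarrow> has_degs B es bs \<Longrightarrow>
    r = wdeg ds + i + wdeg es \<Longrightarrow> s = wint ds + j + wint es \<Longrightarrow> (as, m, bs) \<in> words3_deg A M B r s"
  unfolding words3_deg_def by blast

lemma words3_deg_exists:
  assumes "w \<in> words3 A M B"
  shows "\<exists>r s. w \<in> words3_deg A M B r s"
proof -
  obtain as m bs where w: "w = (as, m, bs)" "as \<in> lists (homog A)" "m \<in> homog M" "bs \<in> lists (homog B)"
    using assms unfolding words3_def by blast
  moreover obtain i j where "m \<in> comp M i j" using w unfolding homog_def by blast
  ultimately show ?thesis
    using has_degs_exists[OF w(2)] has_degs_exists[OF w(4)] unfolding words3_deg_def by blast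
qed

lemma taylor3_comp:
  assumes "taylor3 A M B N e P" "w \<in> words3_deg A M B r s"
  shows "P w \<in> comp N (r + int e) s"
  using assms unfolding taylor3_def words3_deg_def by blast

lemma keys_lift3:
  assumes P: "taylor3 A M B N e P" and w: "(as, m, bs) \<in> words3_deg A M B r s"
    and uv: "u @ v = as" and pq: "p @ q = bs"
  shows "(u, P (v, m, p), q) \<in> words3_deg A N B (r + int e) s"
proof -
  obtain ds es i j where *: "has_degs A ds as" "m \<in> comp M i j" "has_degs B es bs"
     "r = wdeg ds + i + wdeg es" "s = wint ds + j + wint es"
    using w unfolding words3_deg_def by blast
  obtain du dv where u: "ds = du @ dv" "has_degs A du u" "has_degs A dv v"
    using *(1) uv by (auto simp: has_degs_append)
  obtain ep eq where p: "es = ep @ eq" "has_degs B ep p" "has_degs B eq q"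
    using *(3) pq by (auto simp: has_degs_append)
  have "P (v, m, p) \<in> comp N (wdeg dv + i + wdeg ep + int e) (wint dv + j + wint ep)"
    using P u p *(2) unfolding taylor3_def by blast
  then show ?thesis by (rule words3_degI[OF u(2) _ p(3)]) (simp_all add: * u p)
qed

lemma keys_bimod_mor_lift:
  assumes F: "taylor3 A M B N 0 F" and w: "w \<in> words3_deg A M B r s"
  shows "Poly_Mapping.keys (bimod_mor_lift F w :: _ \<Rightarrow>\<^sub>0 'k::field) \<subseteq> words3_deg A N B r s"
proof -
  obtain as m bs where [simp]: "w = (as, m, bs)" by (cases w)
  have "Poly_Mapping.keys (bimod_mor_lift F w :: _ \<Rightarrow>\<^sub>0 'k) \<subseteq>
      (\<Union>i\<le>length as. \<Union>j\<le>length bs. {(take i as, F (drop i as, m, take j bs), drop j bs)})"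
    unfolding bimod_mor_lift_def \<open>w = (as, m, bs)\<close> prod.case
    by (intro order.trans[OF Poly_Mapping.keys_sum] UN_mono order.refl keys_single_subset)
  also have "\<dots> \<subseteq> words3_deg A N B r s"
    using keys_lift3[OF F w[unfolded \<open>w = (as, m, bs)\<close>] append_take_drop_id append_take_drop_id]
    by (intro UN_least) simp
  finally show ?thesis .
qed

lemma keys_codiff:
  assumes dA: "taylor_T A A 2 dA" and dB: "taylor_T B B 2 dB" and dM: "taylor3 A M B M 1 dM"
    and w: "w \<in> words3_deg A M B r s"
  shows "Poly_Mapping.keys (codiff A dA B dB M dM w) \<subseteq> words3_deg A M B (r + 1) s"
proof -
  obtain as m bs where [simp]: "w = (as, m, bs)" by (cases w)
  obtain ds es i j where *: "has_degs A ds as" "m \<in> comp M i j" "has_degs B es bs"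
     "r = wdeg ds + i + wdeg es" "s = wint ds + j + wint es"
    using w unfolding words3_deg_def by auto
  have 1: "Poly_Mapping.keys (lin_ext fscal (\<lambda>u. Poly_Mapping.single (u, m, bs) 1) (coder A dA as))
      \<subseteq> words3_deg A M B (r + 1) s"
  proof
    fix x assume "x \<in> Poly_Mapping.keys (lin_ext fscal (\<lambda>u. Poly_Mapping.single (u, m, bs) 1) (coder A dA as))"
    then obtain u where u: "x = (u, m, bs)" "u \<in> Poly_Mapping.keys (coder A dA as)"
      using keys_lin_ext_subset[of "\<lambda>u. Poly_Mapping.single (u, m, bs) 1" "coder A dA as"]
      by (auto simp: keys_single_subset)
    show "x \<in> words3_deg A M B (r + 1) s"
      using keys_coder_degs[OF dA *(1) u(2)] * unfolding u(1) by (auto intro: words3_degI)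
  qed
  have 2: "Poly_Mapping.keys (\<Sum>i\<le>length as. \<Sum>j\<le>length bs.
        Poly_Mapping.single (take i as, dM (drop i as, m, take j bs), drop j bs)
          ((-1) powi sdeg A (take i as))) \<subseteq> words3_deg A M B (r + 1) s" (is "?X \<subseteq> _")
  proof -
    have "?X \<subseteq> (\<Union>i\<le>length as. \<Union>j\<le>length bs. {(take i as, dM (drop i as, m, take j bs), drop j bs)})"
      by (intro order.trans[OF Poly_Mapping.keys_sum] UN_mono order.refl keys_single_subset)
    also have "\<dots> \<subseteq> words3_deg A M B (r + 1) s"
      using keys_lift3[OF dM w[unfolded \<open>w = (as, m, bs)\<close>] append_take_drop_id append_take_drop_id]
      by (intro UN_least) simp
    finally show ?thesis .
  qed
  have 3: "Poly_Mapping.keys (fscal c (lin_ext fscal (\<lambda>v. Poly_Mapping.single (as, m, v) 1) (coder B dB bs)))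
      \<subseteq> words3_deg A M B (r + 1) s" for c
  proof
    fix x assume "x \<in> Poly_Mapping.keys (fscal c (lin_ext fscal (\<lambda>v. Poly_Mapping.single (as, m, v) 1) (coder B dB bs)))"
    then have "x \<in> Poly_Mapping.keys (lin_ext fscal (\<lambda>v. Poly_Mapping.single (as, m, v) 1) (coder B dB bs))"
      by (rule subsetD[OF keys_fscal])
    then obtain v where v: "x = (as, m, v)" "v \<in> Poly_Mapping.keys (coder B dB bs)"
      using keys_lin_ext_subset[of "\<lambda>v. Poly_Mapping.single (as, m, v) 1" "coder B dB bs"]
      by (auto simp: keys_single_subset)
    show "x \<in> words3_deg A M B (r + 1) s"
      using keys_coder_degs[OF dB *(3) v(2)] * unfolding v(1) by (auto intro: words3_degI)
  qed
  show ?thesis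
    unfolding codiff_def \<open>w = (as, m, bs)\<close> prod.case
    by (intro order.trans[OF Poly_Mapping.keys_add] Un_least 1 2 3)
qed

lemma multilinear3_lin_ext:
  assumes N: "bigraded_space N" and P: "taylor3 A M B N e P" and g: "multilinear3 A N B (*) g"
    and u: "u \<in> lists (homog A)" and q: "q \<in> lists (homog B)"
    and X: "Poly_Mapping.keys X \<subseteq> words3_deg A M B r s"
  shows "g (u, lin_ext (smul N) P X, q) = lin_ext (*) (\<lambda>w. g (u, P w, q)) X"
  using X taylor3_comp[OF P]
  by (intro hlinear_lin_ext[OF N vector_space_mult multilinear3_mid[OF g u q]]) blast

lemma multilinear_T_lin_ext:
  assumes "\<And>b. b \<in> Poly_Mapping.keys p \<Longrightarrow> multilinear_T A (*) (\<lambda>a. g a b)"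
  shows "multilinear_T A (*) (\<lambda>a. lin_ext (*) (g a) p)"
proof (rule multilinear_TI)
  fix us vs assume "us \<in> lists (homog A)" "vs \<in> lists (homog A)"
  then have h: "hlinear A (*) (\<lambda>x. g (us @ x # vs) b)" if "b \<in> Poly_Mapping.keys p" for b
    using multilinear_T_slot[OF assms[OF that]] by blast
  then have add: "g (us @ (x + y) # vs) b = g (us @ x # vs) b + g (us @ y # vs) b"
    if "b \<in> Poly_Mapping.keys p" "x \<in> comp A i j" "y \<in> comp A i j" for b x y i j
    using that unfolding hlinear_def by blast
  have sc: "g (us @ smul A c x # vs) b = c * g (us @ x # vs) b"
    if "b \<in> Poly_Mapping.keys p" "x \<in> homog A" for b x c
    using that h unfolding hlinear_def by blast
  show "hlinear A (*) (\<lambda>x. lin_ext (*) (g (us @ x # vs)) p)"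
    unfolding hlinear_def lin_ext_def
    by (auto simp: add sc distrib_left sum.distrib sum_distrib_left mult.left_commute)
qed

lemma lin_ext_swap: "lin_ext (*) (\<lambda>a. lin_ext (*) (g a) q) p = lin_ext (*) (\<lambda>b. lin_ext (*) (\<lambda>a. g a b) p) q"
  by (simp add: lin_ext_def sum_distrib_left sum.swap[of _ "Poly_Mapping.keys q"] mult.left_commute)

section \<open>Reduction of the codifferential equations to Taylor components\<close>

lemma ainf_algebraD:
  assumes "ainf_algebra V d"
  shows "bigraded_space V" "taylor_T V V 2 d"
  using assms unfolding ainf_algebra_def taylor_T_def by auto

lemma coder_coder:
  assumes "ainf_algebra V d" "vector_space sc" "multilinear_T V sc k" "w \<in> lists (homog V)"
  shows "lin_ext sc (\<lambda>a. lin_ext sc k (coder V d a)) (coder V d w) = 0"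
  unfolding lin_ext_lin_ext[OF assms(2), symmetric]
  by (rule lin_ext_rel_T[OF assms(2,3)]) (use assms(1,4) in \<open>auto simp: ainf_algebra_def\<close>)

lemma opA_opA:
  assumes "ainf_algebra A dA" "multilinear3 A M B (*) g" "(as, m, bs) \<in> words3 A M B"
  shows "opA A dA (opA A dA g) (as, m, bs) = 0"
  unfolding opA_def prod.case
  by (rule coder_coder[OF assms(1) vector_space_mult multilinear3_left[OF assms(2)]])
    (use assms(3) in \<open>auto simp: words3_def\<close>)

lemma opB_opB:
  assumes "ainf_algebra B dB" "multilinear3 A M B (*) g" "(as, m, bs) \<in> words3 A M B"
  shows "opB A B dB M (opB A B dB M g) (as, m, bs) = 0"
  unfolding opB_def prod.case lin_ext_fun_sc[OF vector_space_mult]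
  by (subst coder_coder[OF assms(1) vector_space_mult multilinear3_right[OF assms(2)]])
    (use assms(3) in \<open>auto simp: words3_def\<close>)

text \<open>The operations act on disjoint words, but \<open>opB\<close> carries the Koszul sign of
  the left word, which the odd coderivation on that word flips.\<close>

lemma opA_opB:
  assumes A: "bigraded_space A" "taylor_T A A 2 dA" and B: "taylor_T B B 2 dB"
    and g: "multilinear3 A M B (*) g" and w: "(as, m, bs) \<in> words3 A M B"
  shows "opA A dA (opB A B dB M g) (as, m, bs) + opB A B dB M (opA A dA g) (as, m, bs) = 0"
proof -
  from w have w: "as \<in> lists (homog A)" "m \<in> homog M" "bs \<in> lists (homog B)" by (auto simp: words3_def)
  have "multilinear_T A (*) (\<lambda>a. lin_ext (*) (\<lambda>b. g (a, m, b)) (coder B dB bs))"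
    by (intro multilinear_T_lin_ext multilinear3_left[OF g w(2)] keys_coder_homog[OF B w(3)])
  from lin_ext_coder_weps[OF A this w(1), of 1]
  have "lin_ext (*) (\<lambda>a. (-1) powi (cdeg M m - 1) * (weps A a * lin_ext (*) (\<lambda>b. g (a, m, b)) (coder B dB bs))) (coder A dA as)
      = - ((-1) powi (cdeg M m - 1) * weps A as * lin_ext (*) (\<lambda>b. lin_ext (*) (\<lambda>a. g (a, m, b)) (coder A dA as)) (coder B dB bs))"
    by (simp add: lin_ext_fun_sc[OF vector_space_mult] lin_ext_swap[of _ "coder B dB bs"])
  then show ?thesis by (simp add: opA_def opB_def ac_simps)
qed

theorem codiff_codiff_rel3:
  assumes A: "ainf_algebra A dA" and B: "ainf_algebra B dB" and M: "bigraded_space M"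
    and dM: "taylor3 A M B M 1 dM"
    and taylor: "\<And>w. w \<in> words3 A M B \<Longrightarrow> lin_ext (smul M) dM (codiff A dA B dB M dM w) = 0"
    and w: "w \<in> words3 A M B"
  shows "lin_ext fscal (codiff A dA B dB M dM) (codiff A dA B dB M dM w) \<in> rel3 A M B"
proof (rule mem_rel3I)
  fix g assume g: "multilinear3 A M B (*) g"
  note Ad = ainf_algebraD[OF A] and Bd = ainf_algebraD[OF B]
  let ?D = "codiff A dA B dB M dM"
  let ?A = "opA A dA" and ?B = "opB A B dB M" and ?P = "opP A 1 dM"
  obtain as m bs where w': "w = (as, m, bs)" and as: "as \<in> lists (homog A)" and m: "m \<in> homog M"
    and bs: "bs \<in> lists (homog B)" using w unfolding words3_def by blast
  have sub: "u \<in> lists (homog A) \<and> v \<in> lists (homog A) \<and> p \<in> lists (homog B) \<and> q \<in> lists (homog B)"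
    if "u @ v = as" "p @ q = bs" for u v p q using as bs that by auto
  have "lin_ext (*) g (lin_ext fscal ?D (?D w)) = lin_ext (*) (\<lambda>w. ?A g w + ?P g w + ?B g w) (?D w)"
    by (simp add: lin_ext_lin_ext[OF vector_space_mult] lin_ext_mult_codiff)
  \<comment> \<open>Of the nine products, the two squares and the anticommutator of the outer
    coderivations vanish. The other five add up to the codifferential of the subword (v|m|p) fed
    into dM, summed over all ways to choose that subword.\<close>
  also have "\<dots> = ?A (?A g) w + (?A (?B g) w + ?B (?A g) w) + ?B (?B g) w +
      (?A (?P g) w + ?P (?A g) w) + (?B (?P g) w + ?P (?B g) w) + ?P (?P g) w"
    by (simp add: lin_ext_mult_codiff opA_add opB_add opP_add algebra_simps)
  also have "\<dots> = (?A (?P g) w + ?P (?A g) w) + (?B (?P g) w + ?P (?B g) w) + ?P (?P g) w"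
    using opA_opA[OF A g] opB_opB[OF B g] opA_opB[OF Ad Bd(2) g] w unfolding w' by simp
  also have "\<dots> = decsum as (\<lambda>u v. decsum bs (\<lambda>p q. weps A u ^ 2 * lin_ext (*) (\<lambda>w. g (u, dM w, q)) (?D (v, m, p))))"
  proof -
    have "?A (?P g) w + ?P (?A g) w =
        decsum as (\<lambda>u v. decsum bs (\<lambda>p q. weps A u ^ 2 * ?A (\<lambda>w. g (u, dM w, q)) (v, m, p)))"
      using opA_opP[OF Ad as multilinear3_left[OF g], where bs = bs and m = m and P = dM and e = 1] sub taylor3_homog[OF dM _ m]
      by (simp add: w' numeral_2_eq_2)
    moreover have "?B (?P g) w + ?P (?B g) w =
        decsum as (\<lambda>u v. decsum bs (\<lambda>p q. weps A u ^ 2 * ?B (\<lambda>w. g (u, dM w, q)) (v, m, p)))"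
      using opB_opP[OF Ad(1) M Bd(1) M dM as m bs _ Bd(2), where g = g]
        hlinear_zero[OF M vector_space_mult multilinear3_mid[OF g]]
      by (simp add: w' numeral_2_eq_2)
    moreover have "?P (?P g) w =
        decsum as (\<lambda>u v. decsum bs (\<lambda>p q. weps A u ^ 2 * ?P (\<lambda>w. g (u, dM w, q)) (v, m, p)))"
      by (simp add: w' opP_opP numeral_2_eq_2)
    ultimately show ?thesis
      by (simp add: lin_ext_mult_codiff distrib_left decsum_add)
  qed
  also have "\<dots> = decsum as (\<lambda>u v. decsum bs (\<lambda>p q. 0))"
  proof (intro decsum_cong)
    fix u v p q assume "u @ v = as" "p @ q = bs"
    note uv = sub[OF this]
    then have vmp: "(v, m, p) \<in> words3 A M B" using m by (auto simp: words3_def)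
    \<comment> \<open>The common bidegree of the terms of \<open>?D (v, m, p)\<close> allows their
      sum to be formed before g is applied.\<close>
    obtain r s where "(v, m, p) \<in> words3_deg A M B r s" using words3_deg_exists[OF vmp] by blast
    from multilinear3_lin_ext[OF M dM g _ _ keys_codiff[OF Ad(2) Bd(2) dM this]] uv
    have "lin_ext (*) (\<lambda>w. g (u, dM w, q)) (?D (v, m, p)) = g (u, lin_ext (smul M) dM (?D (v, m, p)), q)"
      by simp
    also have "\<dots> = 0"
      using hlinear_zero[OF M vector_space_mult multilinear3_mid[OF g]] taylor[OF vmp] uv by simp
    finally show "weps A u ^ 2 * lin_ext (*) (\<lambda>w. g (u, dM w, q)) (?D (v, m, p)) = 0" by simp
  qed
  finally show "lin_ext (*) g (lin_ext fscal ?D (?D w)) = 0" by simp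
qed

text \<open>The same collapse with F of degree 0: the commutators with the outer coderivations are
  now ordinary ones, and a single factor \<open>weps A u\<close> survives, coming from the
  codifferential.\<close>

theorem bimod_mor_lift_codiff_rel3:
  assumes A: "ainf_algebra A dA" and B: "ainf_algebra B dB" and M: "bigraded_space M" and N: "bigraded_space N"
    and dM: "taylor3 A M B M 1 dM" and dN: "taylor3 A N B N 1 dN" and F: "taylor3 A M B N 0 F"
    and taylor: "\<And>w. w \<in> words3 A M B \<Longrightarrow>
      lin_ext (smul N) dN (bimod_mor_lift F w) = lin_ext (smul N) F (codiff A dA B dB M dM w)"
    and w: "w \<in> words3 A M B"
  shows "lin_ext fscal (codiff A dA B dB N dN) (bimod_mor_lift F w)
        - lin_ext fscal (bimod_mor_lift F) (codiff A dA B dB M dM w) \<in> rel3 A N B"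
proof (rule mem_rel3I)
  fix g assume g: "multilinear3 A N B (*) g"
  note Ad = ainf_algebraD[OF A] and Bd = ainf_algebraD[OF B]
  let ?DM = "codiff A dA B dB M dM" and ?DN = "codiff A dA B dB N dN"
  let ?A = "opA A dA" and ?BM = "opB A B dB M" and ?BN = "opB A B dB N"
  let ?M = "opP A 1 dM" and ?N = "opP A 1 dN" and ?F = "opP A 0 F"
  obtain as m bs where w': "w = (as, m, bs)" and as: "as \<in> lists (homog A)" and m: "m \<in> homog M"
    and bs: "bs \<in> lists (homog B)" using w unfolding words3_def by blast
  have sub: "u \<in> lists (homog A) \<and> v \<in> lists (homog A) \<and> p \<in> lists (homog B) \<and> q \<in> lists (homog B)"
    if "u @ v = as" "p @ q = bs" for u v p q using as bs that by auto
  have "lin_ext (*) g (lin_ext fscal ?DN (bimod_mor_lift F w) - lin_ext fscal (bimod_mor_lift F) (?DM w))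
      = ?F (\<lambda>w. ?A g w + ?N g w + ?BN g w) w - (?A (?F g) w + ?M (?F g) w + ?BM (?F g) w)"
    by (simp add: lin_ext_diff[OF vector_space_mult] lin_ext_lin_ext[OF vector_space_mult]
        lin_ext_mult_codiff lin_ext_mult_bimod_mor_lift[where A = A])
  also have "\<dots> = ?F (?N g) w - (?A (?F g) w - ?F (?A g) w) - (?BM (?F g) w - ?F (?BN g) w) - ?M (?F g) w"
    by (simp add: opP_add)
  also have "\<dots> = decsum as (\<lambda>u v. decsum bs (\<lambda>p q. weps A u *
       (lin_ext (*) (\<lambda>w. g (u, dN w, q)) (bimod_mor_lift F (v, m, p))
        - lin_ext (*) (\<lambda>w. g (u, F w, q)) (?DM (v, m, p)))))"
  proof -
    have "?A (?F g) w - ?F (?A g) w =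
        decsum as (\<lambda>u v. decsum bs (\<lambda>p q. weps A u * ?A (\<lambda>w. g (u, F w, q)) (v, m, p)))"
      using opA_opP[OF Ad as multilinear3_left[OF g], where bs = bs and m = m and P = F and e = 0] sub taylor3_homog[OF F _ m]
      by (simp add: w')
    moreover have "?BM (?F g) w - ?F (?BN g) w =
        decsum as (\<lambda>u v. decsum bs (\<lambda>p q. weps A u * ?BM (\<lambda>w. g (u, F w, q)) (v, m, p)))"
      using opB_opP[OF Ad(1) M Bd(1) N F as m bs _ Bd(2), where g = g]
        hlinear_zero[OF N vector_space_mult multilinear3_mid[OF g]]
      by (simp add: w')
    moreover have "?M (?F g) w =
        decsum as (\<lambda>u v. decsum bs (\<lambda>p q. weps A u * ?M (\<lambda>w. g (u, F w, q)) (v, m, p)))"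
      by (simp add: w' opP_opP)
    moreover have "?F (?N g) w =
        decsum as (\<lambda>u v. decsum bs (\<lambda>p q. weps A u * ?F (\<lambda>w. g (u, dN w, q)) (v, m, p)))"
      by (simp add: w' opP_opP)
    ultimately show ?thesis
      by (simp add: lin_ext_mult_codiff lin_ext_mult_bimod_mor_lift[where A = A] algebra_simps decsum_add decsum_diff)
  qed
  also have "\<dots> = decsum as (\<lambda>u v. decsum bs (\<lambda>p q. 0))"
  proof (intro decsum_cong)
    fix u v p q assume "u @ v = as" "p @ q = bs"
    note uv = sub[OF this]
    then have vmp: "(v, m, p) \<in> words3 A M B" using m by (auto simp: words3_def)
    obtain r s where rs: "(v, m, p) \<in> words3_deg A M B r s" using words3_deg_exists[OF vmp] by blast
    have "lin_ext (*) (\<lambda>w. g (u, F w, q)) (?DM (v, m, p)) = g (u, lin_ext (smul N) F (?DM (v, m, p)), q)"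
      using multilinear3_lin_ext[OF N F g _ _ keys_codiff[OF Ad(2) Bd(2) dM rs]] uv by simp
    also have "\<dots> = lin_ext (*) (\<lambda>w. g (u, dN w, q)) (bimod_mor_lift F (v, m, p))"
      using multilinear3_lin_ext[OF N dN g _ _ keys_bimod_mor_lift[OF F rs]] uv taylor[OF vmp] by simp
    finally show "weps A u * (lin_ext (*) (\<lambda>w. g (u, dN w, q)) (bimod_mor_lift F (v, m, p))
        - lin_ext (*) (\<lambda>w. g (u, F w, q)) (?DM (v, m, p))) = 0" by simp
  qed
  finally show "lin_ext (*) g (lin_ext fscal ?DN (bimod_mor_lift F w)
      - lin_ext fscal (bimod_mor_lift F) (?DM w)) = 0" by simp
qed

subsection \<open>Taylor components of \<open>A\<^sub>\<infinity>\<close>-relations\<close>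

lemma decsum_last:
  assumes "\<And>u v. u @ v = w \<Longrightarrow> v \<noteq> [] \<Longrightarrow> h u v = 0"
  shows "decsum w h = h w []"
  using assms by (induction w arbitrary: h) auto

lemma decsum_first:
  assumes "\<And>u v. u @ v = w \<Longrightarrow> u \<noteq> [] \<Longrightarrow> h u v = 0"
  shows "decsum w h = h [] w"
  using assms
proof (cases w)
  case (Cons x w')
  have "decsum w' (\<lambda>u. h (x # u)) = decsum w' (\<lambda>u v. 0)"
    using assms Cons by (intro decsum_cong) simp
  then show ?thesis using Cons by simp
qed simp

lemma decsum_inner:
  fixes h :: "'a list \<Rightarrow> 'a list \<Rightarrow> 'v::ab_group_add"
  assumes "w \<noteq> []"
  shows "decsum w h = h [] w + h w [] + decsum w (\<lambda>u v. if u = [] \<or> v = [] then 0 else h u v)"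
proof -
  have "decsum w (\<lambda>u v. h u v - (if u = [] \<or> v = [] then 0 else h u v)) = h [] w + h w []"
    using assms by (subst decsum_ends) auto
  then show ?thesis by (simp add: decsum_diff algebra_simps)
qed

text \<open>The projection of T(V[1]) onto its cogenerators V[1]; composing a lift with it recovers
  the Taylor components.\<close>

definition letter :: "'v list \<Rightarrow> 'v::zero" where
  "letter w = (case w of [x] \<Rightarrow> x | _ \<Rightarrow> 0)"

lemma letter_simps [simp]: "letter [x] = x" "letter [] = 0" "letter (x # y # w) = 0"
  "letter (u @ x # v) = (if u = [] \<and> v = [] then x else 0)"
  by (auto simp: letter_def split: list.splits) (auto simp: append_eq_Cons_conv)

lemma multilinear_T_letter:
  assumes "bigraded_space V"
  shows "multilinear_T V (smul V) letter"
proof (rule multilinear_TI)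
  interpret vector_space "smul V" using assms by (rule bigraded_spaceD)
  fix us vs show "hlinear V (smul V) (\<lambda>x. letter (us @ x # vs))"
    by (cases "us = [] \<and> vs = []") (auto simp: hlinear_def)
qed

text \<open>Only the term whose block is the whole word leaves a single letter. The empty word is
  set apart because \<open>d []\<close> may be any value.\<close>

lemma lin_ext_letter_coder:
  assumes sc: "vector_space sc"
  shows "lin_ext sc letter (coder V d w) = (if w = [] then 0 else d w)"
proof (cases w)
  case (Cons a w')
  interpret vector_space sc by (rule sc)
  have "lin_ext sc letter (coder V d w) = decsum w (\<lambda>v x. if v = [] then 0 else letter (d v # x))"
    unfolding lin_ext_coder[OF sc] by (subst decsum_first) (auto simp: Cons_eq_append_conv cong: if_cong)
  also have "\<dots> = d w"
    using Cons by (subst decsum_last) (auto simp: neq_Nil_conv)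
  finally show ?thesis using Cons by simp
qed (simp add: lin_ext_coder[OF sc])

text \<open>The square of the coderivation vanishes only modulo \<open>rel_T\<close>. As
  \<open>letter\<close> is multilinear it kills these relations, and an equation in V
  remains.\<close>

lemma ainf_algebra_taylor:
  assumes V: "ainf_algebra V d" and w: "w \<in> lists (homog V)"
  shows "lin_ext (smul V) d (coder V d w) = 0"
proof -
  note sc = bigraded_spaceD(1)[OF ainf_algebraD(1)[OF V]]
  have "lin_ext (smul V) d (coder V d w) = lin_ext (smul V) (\<lambda>a. lin_ext (smul V) letter (coder V d a)) (coder V d w)"
    by (rule lin_ext_coder_cong[OF sc]) (simp add: lin_ext_letter_coder[OF sc])
  also have "\<dots> = 0"
    by (rule coder_coder[OF V sc multilinear_T_letter[OF ainf_algebraD(1)[OF V]] w])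
  finally show ?thesis .
qed

section \<open>Taylor components of morphism equations\<close>

definition cuts :: "'a list \<Rightarrow> 'a list list set" where
  "cuts w = {ws. concat ws = w \<and> [] \<notin> set ws}"

lemma finite_cuts: "finite (cuts w)"
proof (rule finite_subset)
  have "length ws \<le> length (concat ws)" if "[] \<notin> set ws" for ws :: "'a list list"
    using that
  proof (induction ws)
    case (Cons u ws)
    then have "length u > 0" "length ws \<le> length (concat ws)" by auto
    then have "Suc (length ws) \<le> length u + length (concat ws)" by linarith
    then show ?case by simp
  qed simp
  moreover have "u \<in> {u. set u \<subseteq> set (concat ws) \<and> length u \<le> length (concat ws)}" if "u \<in> set ws" for u ws
    using that by (induction ws) auto
  ultimately show "cuts w \<subseteq> {ws. set ws \<subseteq> {u. set u \<subseteq> set w \<and> length u \<le> length w} \<and> length ws \<le> length w}"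
    unfolding cuts_def by blast
qed (intro finite_lists_length_le finite_set)

text \<open>When h ignores three or more blocks, only the uncut word and the cuts into two blocks
  contribute; the latter are indexed by the position of the cut.\<close>

lemma lin_ext_alg_mor_lift:
  assumes sc: "vector_space sc" and w: "w \<noteq> []"
    and h: "\<And>ws. ws \<in> cuts w \<Longrightarrow> length ws \<ge> 3 \<Longrightarrow> h (map f ws) = 0"
  shows "lin_ext sc h (alg_mor_lift f w) =
    h [f w] + decsum w (\<lambda>u v. if u = [] \<or> v = [] then 0 else h [f u, f v])"
proof -
  interpret vector_space sc by (rule sc)
  let ?C = "(\<lambda>i. [take i w, drop i w]) ` {1..<length w}"
  have "lin_ext sc h (alg_mor_lift f w) = (\<Sum>ws\<in>cuts w. h (map f ws))"
    by (simp add: alg_mor_lift_def cuts_def lin_ext_sum[OF sc] lin_ext_single[OF sc])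
  also have "\<dots> = (\<Sum>ws\<in>insert [w] ?C. h (map f ws))"
  proof (rule sum.mono_neutral_right[OF finite_cuts])
    show "insert [w] ?C \<subseteq> cuts w" using w by (auto simp: cuts_def)
    show "\<forall>ws\<in>cuts w - insert [w] ?C. h (map f ws) = 0"
    proof
      fix ws assume ws: "ws \<in> cuts w - insert [w] ?C"
      have "length ws \<ge> 3"
      proof (rule ccontr)
        assume "\<not> length ws \<ge> 3"
        then have "length ws = 0 \<or> length ws = 1 \<or> length ws = 2" by linarith
        then consider "ws = []" | u where "ws = [u]" | u v where "ws = [u, v]"
          by (auto simp: length_Suc_conv numeral_2_eq_2)
        then show False
        proof cases
          case (3 u v)
          then have "ws = [take (length u) w, drop (length u) w]" "length u \<in> {1..<length w}"
            using ws by (auto simp: cuts_def Suc_le_eq)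
          then show False using ws by blast
        qed (use ws w in \<open>auto simp: cuts_def\<close>)
      qed
      then show "h (map f ws) = 0" using h ws by blast
    qed
  qed
  also have "\<dots> = h [f w] + (\<Sum>ws\<in>?C. h (map f ws))"
    by (subst sum.insert) auto
  also have "(\<Sum>ws\<in>?C. h (map f ws)) = (\<Sum>i\<in>{1..<length w}. h [f (take i w), f (drop i w)])"
    by (subst sum.reindex) (auto simp: inj_on_def dest!: arg_cong[of "take _ _" _ length])
  also have "\<dots> = decsum w (\<lambda>u v. if u = [] \<or> v = [] then 0 else h [f u, f v])"
    unfolding decsum_eq_sum by (rule sum.mono_neutral_cong_left) auto
  finally show ?thesis .
qed

lemma lin_ext_letter_alg_mor_lift:
  assumes sc: "vector_space sc" and w: "w \<noteq> []"
  shows "lin_ext sc letter (alg_mor_lift f w) = f w"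
proof -
  have "letter (map f ws) = 0" if "length ws \<ge> 3" for ws
    using that by (auto simp: letter_def split: list.splits)
  then show ?thesis
    by (subst lin_ext_alg_mor_lift[OF sc w]) (auto cong: if_cong)
qed

lemma keys_alg_mor_lift: "Poly_Mapping.keys (alg_mor_lift f w :: _ \<Rightarrow>\<^sub>0 'k::field) \<subseteq> map f ` cuts w"
proof -
  have "Poly_Mapping.keys (alg_mor_lift f w :: _ \<Rightarrow>\<^sub>0 'k) \<subseteq> (\<Union>ws\<in>cuts w. {map f ws})"
    unfolding alg_mor_lift_def cuts_def
    by (intro order.trans[OF Poly_Mapping.keys_sum] UN_mono order.refl keys_single_subset)
  then show ?thesis by blast
qed

lemma cuts_degs:
  assumes f: "taylor_T V W 1 f" and "has_degs V ds (concat ws)" "[] \<notin> set ws"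
  shows "\<exists>es. has_degs W es (map f ws) \<and> wdeg es = wdeg ds \<and> wint es = wint ds"
  using assms(2,3)
proof (induction ws arbitrary: ds)
  case (Cons u ws)
  then obtain du dv where ds: "ds = du @ dv" "has_degs V du u" "has_degs V dv (concat ws)"
    by (auto simp: has_degs_append)
  then obtain es where es: "has_degs W es (map f ws)" "wdeg es = wdeg dv" "wint es = wint dv"
    using Cons by auto
  have "f u \<in> comp W (wdeg du + 1) (wint du)"
    using f ds(2) Cons.prems(2) unfolding taylor_T_def by auto
  with ds es show ?case
    by (intro exI[of _ "(wdeg du + 1, wint du) # es"]) auto
qed auto

lemma ainf_algebra_morphismD:
  "ainf_algebra_morphism V dV W dW f \<Longrightarrow> taylor_T V W 1 f"
  by (auto simp: ainf_algebra_morphism_def taylor_T_def)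

lemma ainf_morphism_taylor:
  fixes V :: "('k::field, 'a::ab_group_add) bigraded" and W :: "('k, 'b::ab_group_add) bigraded"
  assumes V: "ainf_algebra V dV" and W: "ainf_algebra W dW" and f: "ainf_algebra_morphism V dV W dW f"
    and w: "w \<in> lists (homog V)" "w \<noteq> []"
  shows "lin_ext (smul W) dW (alg_mor_lift f w) = lin_ext (smul W) f (coder V dV w)"
proof -
  note Wd = ainf_algebraD[OF W]
  note sc = bigraded_spaceD(1)[OF Wd(1)]
  have "lin_ext fscal (coder W dW) (alg_mor_lift f w) - lin_ext fscal (alg_mor_lift f) (coder V dV w) \<in> rel_T W"
    using f w by (auto simp: ainf_algebra_morphism_def)
  from lin_ext_rel_T[OF sc multilinear_T_letter[OF Wd(1)] this]
  have "lin_ext (smul W) (\<lambda>a. lin_ext (smul W) letter (coder W dW a)) (alg_mor_lift f w) =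
      lin_ext (smul W) (\<lambda>a. lin_ext (smul W) letter (alg_mor_lift f a)) (coder V dV w)"
    by (simp add: lin_ext_diff[OF sc] lin_ext_lin_ext[OF sc])
  moreover have "lin_ext (smul W) (\<lambda>a. lin_ext (smul W) letter (coder W dW a)) (alg_mor_lift f w) =
      lin_ext (smul W) dW (alg_mor_lift f w)"
  proof (rule lin_ext_cong[OF sc])
    fix a :: "'b list" assume "a \<in> Poly_Mapping.keys (alg_mor_lift f w :: _ \<Rightarrow>\<^sub>0 'k)"
    then have "a \<noteq> []" using keys_alg_mor_lift[of f w] w(2) by (auto simp: cuts_def)
    then show "lin_ext (smul W) letter (coder W dW a) = dW a"
      by (simp add: lin_ext_letter_coder[OF sc])
  qed
  moreover have "lin_ext (smul W) (\<lambda>a. lin_ext (smul W) letter (alg_mor_lift f a)) (coder V dV w) =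
      lin_ext (smul W) f (coder V dV w)"
    by (rule lin_ext_coder_cong[OF sc]) (simp add: lin_ext_letter_alg_mor_lift[OF sc])
  ultimately show ?thesis by simp
qed

text \<open>The codifferential of the diagonal bimodule is the coderivation itself, read on words
  with a marked letter m. Its three summands correspond to blocks left of m, containing m, and right
  of m.\<close>

lemma lin_ext_codiff_diag:
  assumes sc: "vector_space sc"
  shows "lin_ext sc (\<lambda>(as, m, bs). h (as @ m # bs)) (codiff A d A d A (diag_bimodule d) (as, m, bs)) =
    lin_ext sc h (coder A d (as @ m # bs))"
proof -
  interpret vector_space sc by (rule sc)
  let ?em = "(-1) powi (cdeg A m - 1)"
  define H where "H = (\<lambda>u v x. if v = [] then 0 else sc (weps A u) (h (u @ d v # x)))"
  have "lin_ext sc h (coder A d (as @ m # bs)) = decsum (as @ m # bs) (\<lambda>u y. decsum y (H u))"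
    by (simp add: lin_ext_coder[OF sc] H_def)
  also have "\<dots> = decsum as (\<lambda>u b. decsum b (\<lambda>v x. H u v (x @ m # bs))) +
      decsum as (\<lambda>u b. decsum bs (\<lambda>p. H u (b @ m # p))) +
      decsum bs (\<lambda>p b. decsum b (H (as @ m # p)))"
    by (simp add: decsum_append_Cons decsum_add)
  also have "decsum as (\<lambda>u b. decsum b (\<lambda>v x. H u v (x @ m # bs))) =
      lin_ext sc (\<lambda>a. h (a @ m # bs)) (coder A d as)"
    by (simp add: lin_ext_coder[OF sc] H_def cong: if_cong)
  also have "decsum bs (\<lambda>p b. decsum b (H (as @ m # p))) =
      sc (weps A as * ?em) (lin_ext sc (\<lambda>b. h (as @ m # b)) (coder A d bs))"
    by (subst lin_ext_fun_sc[OF sc, symmetric], subst lin_ext_coder[OF sc], intro decsum_cong)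
      (simp add: H_def weps_append weps_Cons ac_simps)
  finally show ?thesis
    by (simp add: lin_ext_codiff[OF sc] diag_bimodule_def H_def)
qed

subsection \<open>Pullback of the diagonal bimodule\<close>

text \<open>
  The bimodule structure on \<open>W\<close> obtained by pulling back the diagonal bimodule along \<open>f\<close>, when \<open>dW\<close>
  has only unary and binary components.
\<close>

definition pullback_bimodule :: "('b list \<Rightarrow> 'b::zero) \<Rightarrow> ('a list \<Rightarrow> 'b) \<Rightarrow> 'a list \<times> 'b \<times> 'a list \<Rightarrow> 'b" where
  "pullback_bimodule dW f = (\<lambda>(as, x, cs).
     if as = [] \<and> cs = [] then dW [x] else if cs = [] then dW [f as, x]
     else if as = [] then dW [x, f cs] else 0)"

lemma hlinear_compose:
  assumes "hlinear V (smul W) f" "\<And>i j x. x \<in> comp V i j \<Longrightarrow> f x \<in> comp W (i + a) (j + b)" "hlinear W sc g"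
  shows "hlinear V sc (\<lambda>x. g (f x))"
  unfolding hlinear_def
proof (intro conjI allI ballI)
  fix i j x y assume "x \<in> comp V i j" "y \<in> comp V i j"
  then show "g (f (x + y)) = g (f x) + g (f y)"
    using assms(1,3) assms(2)[of x i j] assms(2)[of y i j] unfolding hlinear_def by metis
next
  fix c x assume "x \<in> homog V"
  moreover from this have "f x \<in> homog W" using assms(2) unfolding homog_def by blast
  ultimately show "g (f (smul V c x)) = sc c (g (f x))"
    using assms(1,3) unfolding hlinear_def by simp
qed

lemma hlinear_const_zero: "vector_space sc \<Longrightarrow> hlinear V sc (\<lambda>x. 0)"
  using module.scale_zero_right[of sc] unfolding hlinear_def vector_space_def module_def by simp

text \<open>A word with an open slot is never empty, so h is free at \<open>[]\<close>. This makes
  the case split of \<open>pullback_bimodule\<close> on empty words compatible with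
  multilinearity.\<close>

lemma multilinear_T_compose:
  assumes f: "taylor_T V W e f" and g: "hlinear W sc g"
    and h: "\<And>w. w \<noteq> [] \<Longrightarrow> h w = g (f w)"
  shows "multilinear_T V sc h"
proof (rule multilinear_TI)
  fix us vs assume uv: "us \<in> lists (homog V)" "vs \<in> lists (homog V)"
  obtain du dv where d: "has_degs V du us" "has_degs V dv vs"
    using has_degs_exists[OF uv(1)] has_degs_exists[OF uv(2)] by blast
  have "hlinear V sc (\<lambda>x. g (f (us @ x # vs)))"
  proof (rule hlinear_compose[OF _ _ g])
    show "hlinear V (smul W) (\<lambda>x. f (us @ x # vs))"
      using f uv by (intro multilinear_T_slot) (auto simp: taylor_T_def)
    fix i j x assume x: "x \<in> comp V i j"
    have "has_degs V (du @ (i, j) # dv) (us @ x # vs)"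
      using d x by (intro has_degs_appendI) auto
    then have "f (us @ x # vs) \<in> comp W (wdeg (du @ (i, j) # dv) + e) (wint (du @ (i, j) # dv))"
      using f unfolding taylor_T_def by blast
    then show "f (us @ x # vs) \<in> comp W (i + (wdeg du + wdeg dv - 1 + e)) (j + (wint du + wint dv))"
      by (simp add: algebra_simps)
  qed
  then show "hlinear V sc (\<lambda>x. h (us @ x # vs))" by (simp add: h)
qed

text \<open>Marking a letter removes its shift from the degree count, hence \<open>int e + 1\<close>
  in the hypothesis.\<close>

lemma taylor3_diag:
  assumes f: "taylor_T V W (int e + 1) f"
  shows "taylor3 V V V W e (\<lambda>(as, a, bs). f (as @ a # bs))"
  unfolding taylor3_def
proof (intro conjI allI impI multilinear3I)
  have ml: "multilinear_T V (smul W) f" using f by (simp add: taylor_T_def)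
  { fix m bs assume "m \<in> homog V" "bs \<in> lists (homog V)"
    then show "multilinear_T V (smul W) (\<lambda>a. case (a, m, bs) of (as, a, bs) \<Rightarrow> f (as @ a # bs))"
      using multilinear_T_slot[OF ml] by (intro multilinear_TI) simp }
  { fix as bs assume "as \<in> lists (homog V)" "bs \<in> lists (homog V)"
    then show "hlinear V (smul W) (\<lambda>m. case (as, m, bs) of (as, a, bs) \<Rightarrow> f (as @ a # bs))"
      using multilinear_T_slot[OF ml] by simp }
  { fix m as assume as: "as \<in> lists (homog V)" "m \<in> homog V"
    have "hlinear V (smul W) (\<lambda>x. f ((as @ m # us) @ x # vs))"
      if "us \<in> lists (homog V)" "vs \<in> lists (homog V)" for us vs
      by (rule multilinear_T_slot[OF ml]) (use as that in auto)
    then show "multilinear_T V (smul W) (\<lambda>b. case (as, m, b) of (as, a, bs) \<Rightarrow> f (as @ a # bs))"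
      by (intro multilinear_TI) simp }
  fix ds as i j m es bs
  assume *: "has_degs V ds as \<and> m \<in> comp V i j \<and> has_degs V es bs"
  then have "has_degs V (ds @ (i, j) # es) (as @ m # bs)" by (intro has_degs_appendI) auto
  then have "f (as @ m # bs) \<in> comp W (wdeg (ds @ (i, j) # es) + (int e + 1)) (wint (ds @ (i, j) # es))"
    using f unfolding taylor_T_def by blast
  then show "(case (as, m, bs) of (as, a, bs) \<Rightarrow> f (as @ a # bs)) \<in>
      comp W (wdeg ds + i + wdeg es + int e) (wint ds + j + wint es)"
    by (simp add: algebra_simps)
qed

lemma ainf_bimodule_diag:
  assumes V: "ainf_algebra V d"
  shows "ainf_bimodule V d V d V (diag_bimodule d)"
proof -
  note Vd = ainf_algebraD[OF V]
  have t: "taylor3 V V V V 1 (diag_bimodule d)"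
    using taylor3_diag[of V V 1 d] Vd(2) by (simp add: diag_bimodule_def)
  have "lin_ext fscal (codiff V d V d V (diag_bimodule d)) (codiff V d V d V (diag_bimodule d) w) \<in> rel3 V V V"
    if w: "w \<in> words3 V V V" for w
  proof (rule codiff_codiff_rel3[OF V V Vd(1) t _ w])
    fix w assume "w \<in> words3 V V V"
    then obtain as m bs where w: "w = (as, m, bs)" and "as @ m # bs \<in> lists (homog V)"
      unfolding words3_def by auto
    then show "lin_ext (smul V) (diag_bimodule d) (codiff V d V d V (diag_bimodule d) w) = 0"
      using ainf_algebra_taylor[OF V]
        lin_ext_codiff_diag[OF bigraded_spaceD(1)[OF Vd(1)], of d V d as m bs]
      unfolding w diag_bimodule_def by simp
  qed
  with t V Vd(1) show ?thesis by (auto simp: ainf_bimodule_def taylor3_def)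
qed

lemma strictly_unital_bimodule_diag:
  assumes "strictly_unital_algebra V d e"
  shows "strictly_unital_bimodule V e V e V (diag_bimodule d)"
  using assms by (auto simp: strictly_unital_bimodule_def strictly_unital_algebra_def diag_bimodule_def words3_def)

section \<open>Morphisms into a target with only unary and binary operations\<close>

context
  fixes V :: "('k::field, 'a::ab_group_add) bigraded" and W :: "('k, 'b::ab_group_add) bigraded"
    and dV dW f
  assumes V: "ainf_algebra V dV" and W: "ainf_algebra W dW" and f: "ainf_algebra_morphism V dV W dW f"
    and dW_3: "\<And>w. length w \<ge> 3 \<Longrightarrow> dW w = 0"
begin

interpretation W: vector_space "smul W"
  by (rule bigraded_spaceD[OF ainf_algebraD(1)[OF W]])

lemma target_space: "bigraded_space W" "taylor_T W W 2 dW" "vector_space (smul W)"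
  using ainf_algebraD[OF W] bigraded_spaceD by auto

lemma morphism_homog: "u \<in> lists (homog V) \<Longrightarrow> u \<noteq> [] \<Longrightarrow> f u \<in> homog W"
  using taylor_T_homog[OF ainf_algebra_morphismD[OF f]] by blast

lemma target_homog: "x \<in> homog W \<Longrightarrow> dW [x] \<in> homog W"
  "x \<in> homog W \<Longrightarrow> y \<in> homog W \<Longrightarrow> dW [x, y] \<in> homog W"
  using taylor_T_homog[OF target_space(2)] by auto

lemma target_hlinear:
  "hlinear W (smul W) (\<lambda>x. dW [x])"
  "y \<in> homog W \<Longrightarrow> hlinear W (smul W) (\<lambda>x. dW [x, y])"
  "y \<in> homog W \<Longrightarrow> hlinear W (smul W) (\<lambda>x. dW [y, x])"
proof -
  have ml: "multilinear_T W (smul W) dW" using target_space(2) by (simp add: taylor_T_def)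
  show "hlinear W (smul W) (\<lambda>x. dW [x])" using multilinear_T_slot[OF ml, of "[]" "[]"] by simp
  assume y: "y \<in> homog W"
  then show "hlinear W (smul W) (\<lambda>x. dW [x, y])" using multilinear_T_slot[OF ml, of "[]" "[y]"] by simp
  from y show "hlinear W (smul W) (\<lambda>x. dW [y, x])" using multilinear_T_slot[OF ml, of "[y]" "[]"] by simp
qed

lemma target_zero:
  "dW [0] = 0" "y \<in> homog W \<Longrightarrow> dW [0, y] = 0" "y \<in> homog W \<Longrightarrow> dW [y, 0] = 0"
  using target_hlinear hlinear_zero[OF target_space(1,3)] by auto

text \<open>In shifted signs: the differential squares to zero, it is a derivation of the product,
  and the product is associative, all terms with a ternary operation being zero.\<close>

lemma target_relations:
  "x \<in> homog W \<Longrightarrow> dW [dW [x]] = 0"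
  "x \<in> homog W \<Longrightarrow> y \<in> homog W \<Longrightarrow>
     dW [dW [x], y] + dW [dW [x, y]] + smul W ((-1) powi (cdeg W x - 1)) (dW [x, dW [y]]) = 0"
  "x \<in> homog W \<Longrightarrow> y \<in> homog W \<Longrightarrow> z \<in> homog W \<Longrightarrow>
     dW [dW [x, y], z] + smul W ((-1) powi (cdeg W x - 1)) (dW [x, dW [y, z]]) = 0"
  using ainf_algebra_taylor[OF W, of "[x]"] ainf_algebra_taylor[OF W, of "[x, y]"]
    ainf_algebra_taylor[OF W, of "[x, y, z]"]
  by (simp_all add: lin_ext_coder[OF target_space(3)] weps_Cons dW_3 target_zero add.assoc)

text \<open>As f has degree 0 between the shifted spaces, \<open>f u\<close> carries the Koszul sign
  of u. If \<open>f u = 0\<close> its degree is the default one, and y must vanish as well.\<close>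

lemma smul_morphism_sign:
  assumes u: "u \<in> lists (homog V)" "u \<noteq> []" and y: "f u = 0 \<Longrightarrow> y = 0"
  shows "smul W ((-1) powi (cdeg W (f u) - 1)) y = smul W (weps V u) y"
proof (cases "f u = 0")
  case False
  then have "cdeg W (f u) - 1 = sdeg V u"
    using cdeg_taylor_T[OF ainf_algebraD(1)[OF V] target_space(1) ainf_algebra_morphismD[OF f]] u by simp
  then show ?thesis by (simp add: weps_def)
qed (simp add: y)

lemma morphism_relations:
  assumes u: "u \<in> lists (homog V)" "u \<noteq> []"
  shows "x \<in> homog W \<Longrightarrow> dW [dW [f u], x] + dW [dW [f u, x]] + smul W (weps V u) (dW [f u, dW [x]]) = 0"
    and "x \<in> homog W \<Longrightarrow> y \<in> homog W \<Longrightarrow>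
      dW [dW [f u, x], y] + smul W (weps V u) (dW [f u, dW [x, y]]) = 0"
proof -
  note fu = morphism_homog[OF u]
  { assume x: "x \<in> homog W"
    have "smul W ((-1) powi (cdeg W (f u) - 1)) (dW [f u, dW [x]]) = smul W (weps V u) (dW [f u, dW [x]])"
      by (rule smul_morphism_sign[OF u]) (simp add: target_zero target_homog x)
    then show "dW [dW [f u], x] + dW [dW [f u, x]] + smul W (weps V u) (dW [f u, dW [x]]) = 0"
      using target_relations(2)[OF fu x] by (simp only:) }
  { assume xy: "x \<in> homog W" "y \<in> homog W"
    have "smul W ((-1) powi (cdeg W (f u) - 1)) (dW [f u, dW [x, y]]) = smul W (weps V u) (dW [f u, dW [x, y]])"
      by (rule smul_morphism_sign[OF u]) (simp add: target_zero target_homog xy)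
    then show "dW [dW [f u, x], y] + smul W (weps V u) (dW [f u, dW [x, y]]) = 0"
      using target_relations(3)[OF fu xy] by (simp only:) }
qed

text \<open>The morphism equation seen through a linear map g. In the applications g is the product
  with a fixed element on either side, or the identity.\<close>

lemma morphism_taylor_hlinear:
  assumes g: "hlinear W (smul W) g" and w: "w \<in> lists (homog V)" "w \<noteq> []"
  shows "lin_ext (smul W) (\<lambda>a. g (f a)) (coder V dV w) =
    g (dW [f w]) + decsum w (\<lambda>u v. if u = [] \<or> v = [] then 0 else g (dW [f u, f v]))"
proof -
  note Vd = ainf_algebraD[OF V] and fd = ainf_algebra_morphismD[OF f]
  obtain ds where ds: "has_degs V ds w" using has_degs_exists[OF w(1)] by blast
  have "g (lin_ext (smul W) f (coder V dV w)) = lin_ext (smul W) (\<lambda>a. g (f a)) (coder V dV w)"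
  proof (rule hlinear_lin_ext[OF target_space(1,3) g, where i = "wdeg ds + 2" and j = "wint ds"])
    fix a assume a: "a \<in> Poly_Mapping.keys (coder V dV w)"
    then have "a \<noteq> []" using keys_coder by fastforce
    moreover obtain es where es: "has_degs V es a" "wdeg es = wdeg ds + 1" "wint es = wint ds"
      using keys_coder_degs[OF Vd(2) ds a] by blast
    ultimately have "f a \<in> comp W (wdeg es + 1) (wint es)"
      using fd unfolding taylor_T_def by blast
    then show "f a \<in> comp W (wdeg ds + 2) (wint ds)" by (simp add: es add.commute)
  qed
  moreover have "g (lin_ext (smul W) dW (alg_mor_lift f w)) =
      lin_ext (smul W) (\<lambda>a. g (dW a)) (alg_mor_lift f w)"
  proof (rule hlinear_lin_ext[OF target_space(1,3) g, where i = "wdeg ds + 2" and j = "wint ds"])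
    fix a assume "a \<in> Poly_Mapping.keys (alg_mor_lift f w :: _ \<Rightarrow>\<^sub>0 'k)"
    then obtain ws where ws: "a = map f ws" "concat ws = w" "[] \<notin> set ws"
      using keys_alg_mor_lift[of f w] by (auto simp: cuts_def)
    then obtain es where es: "has_degs W es a" "wdeg es = wdeg ds" "wint es = wint ds"
      using cuts_degs[OF fd, of ds ws] ds by auto
    moreover have "a \<noteq> []" using ws w(2) by auto
    ultimately have "dW a \<in> comp W (wdeg es + 2) (wint es)"
      using target_space(2) unfolding taylor_T_def by blast
    then show "dW a \<in> comp W (wdeg ds + 2) (wint ds)" by (simp add: es add.commute)
  qed
  moreover have "lin_ext (smul W) (\<lambda>a. g (dW a)) (alg_mor_lift f w) =
      g (dW [f w]) + decsum w (\<lambda>u v. if u = [] \<or> v = [] then 0 else g (dW [f u, f v]))"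
    by (rule lin_ext_alg_mor_lift[OF target_space(3) w(2)])
      (simp add: dW_3 hlinear_zero[OF target_space(1,3) g])
  ultimately show ?thesis using ainf_morphism_taylor[OF V W f w] by simp
qed

lemma taylor3_pullback: "taylor3 V W V W 1 (pullback_bimodule dW f)"
  unfolding taylor3_def
proof (intro conjI allI impI multilinear3I)
  note fd = ainf_algebra_morphismD[OF f]
  { fix m bs assume m: "m \<in> homog W" "bs \<in> lists (homog V)"
    show "multilinear_T V (smul W) (\<lambda>a. pullback_bimodule dW f (a, m, bs))"
    proof (cases "bs = []")
      case True
      then show ?thesis
        by (intro multilinear_T_compose[OF fd target_hlinear(2)[OF m(1)]]) (simp add: pullback_bimodule_def)
    next
      case False
      then show ?thesis
        by (intro multilinear_T_compose[OF fd hlinear_const_zero[OF target_space(3)]])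
          (simp add: pullback_bimodule_def)
    qed }
  { fix as bs assume "as \<in> lists (homog V)" "bs \<in> lists (homog V)"
    then show "hlinear W (smul W) (\<lambda>m. pullback_bimodule dW f (as, m, bs))"
      using target_hlinear morphism_homog hlinear_const_zero[OF target_space(3)]
      by (cases "as = []"; cases "bs = []") (simp_all add: pullback_bimodule_def) }
  { fix as m assume m: "as \<in> lists (homog V)" "m \<in> homog W"
    show "multilinear_T V (smul W) (\<lambda>b. pullback_bimodule dW f (as, m, b))"
    proof (cases "as = []")
      case True
      then show ?thesis
        by (intro multilinear_T_compose[OF fd target_hlinear(3)[OF m(2)]]) (simp add: pullback_bimodule_def)
    next
      case False
      then show ?thesis
        by (intro multilinear_T_compose[OF fd hlinear_const_zero[OF target_space(3)]])
          (simp add: pullback_bimodule_def)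
    qed }
  fix ds as i j m es bs
  assume *: "has_degs V ds as \<and> m \<in> comp W i j \<and> has_degs V es bs"
  have fc: "f u \<in> comp W (wdeg ds + 1) (wint ds)" if "u \<noteq> []" "has_degs V ds u" for ds u
    using fd that unfolding taylor_T_def by blast
  have dc: "dW w \<in> comp W (wdeg ds + 2) (wint ds)" if "w \<noteq> []" "has_degs W ds w" for ds w
    using target_space(2) that unfolding taylor_T_def by blast
  show "pullback_bimodule dW f (as, m, bs) \<in>
      comp W (wdeg ds + i + wdeg es + int 1) (wint ds + j + wint es)"
  proof (cases "as = []"; cases "bs = []")
    assume "as = []" "bs = []"
    then show ?thesis
      using * dc[of "[m]" "[(i, j)]"] by (simp add: pullback_bimodule_def add.commute)
  next
    assume "as = []" "bs \<noteq> []"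
    then show ?thesis
      using * fc[of bs es] dc[of "[m, f bs]" "[(i, j), (wdeg es + 1, wint es)]"]
      by (simp add: pullback_bimodule_def algebra_simps)
  next
    assume "as \<noteq> []" "bs = []"
    then show ?thesis
      using * fc[of as ds] dc[of "[f as, m]" "[(wdeg ds + 1, wint ds), (i, j)]"]
      by (simp add: pullback_bimodule_def algebra_simps)
  next
    assume "as \<noteq> []" "bs \<noteq> []"
    then show ?thesis
      using bigraded_zero_mem(1)[OF target_space(1)] by (simp add: pullback_bimodule_def)
  qed
qed

lemma pullback_zero:
  "as \<in> lists (homog V) \<Longrightarrow> cs \<in> lists (homog V) \<Longrightarrow> pullback_bimodule dW f (as, 0, cs) = 0"
  by (simp add: pullback_bimodule_def target_zero morphism_homog)

text \<open>With no algebra arguments this is the square of the differential. With arguments on one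
  side, the morphism equation combines with the derivation rule and associativity. With arguments on
  both sides, associativity of \<open>f as\<close>, x and \<open>f cs\<close> is all that
  remains.\<close>

lemma pullback_taylor:
  assumes as: "as \<in> lists (homog V)" and x: "x \<in> homog W" and cs: "cs \<in> lists (homog V)"
  shows "lin_ext (smul W) (pullback_bimodule dW f)
    (codiff V dV V dV W (pullback_bimodule dW f) (as, x, cs)) = 0"
proof -
  let ?d = "pullback_bimodule dW f"
  let ?ex = "(-1) powi (cdeg W x - 1)"
  have L: "lin_ext (smul W) (\<lambda>a. ?d (a, x, cs)) (coder V dV as) =
      (if as \<noteq> [] \<and> cs = [] then lin_ext (smul W) (\<lambda>a. dW [f a, x]) (coder V dV as) else 0)"
  proof -
    have "lin_ext (smul W) (\<lambda>a. ?d (a, x, cs)) (coder V dV as) =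
        lin_ext (smul W) (\<lambda>a. if cs = [] then dW [f a, x] else 0) (coder V dV as)"
      by (rule lin_ext_coder_cong[OF target_space(3)]) (simp add: pullback_bimodule_def)
    then show ?thesis
      by (cases "as = []"; cases "cs = []")
        (simp_all add: coder_Nil lin_ext_zero_fun[OF target_space(3)] lin_ext_zero[OF target_space(3)])
  qed
  have R: "lin_ext (smul W) (\<lambda>b. ?d (as, x, b)) (coder V dV cs) =
      (if cs \<noteq> [] \<and> as = [] then lin_ext (smul W) (\<lambda>b. dW [x, f b]) (coder V dV cs) else 0)"
  proof -
    have "lin_ext (smul W) (\<lambda>b. ?d (as, x, b)) (coder V dV cs) =
        lin_ext (smul W) (\<lambda>b. if as = [] then dW [x, f b] else 0) (coder V dV cs)"
      by (rule lin_ext_coder_cong[OF target_space(3)]) (simp add: pullback_bimodule_def)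
    then show ?thesis
      by (cases "as = []"; cases "cs = []")
        (simp_all add: coder_Nil lin_ext_zero_fun[OF target_space(3)] lin_ext_zero[OF target_space(3)])
  qed
  consider "as = []" "cs = []" | "as \<noteq> []" "cs = []" | "as = []" "cs \<noteq> []" | "as \<noteq> []" "cs \<noteq> []" by blast
  then have "lin_ext (smul W) (\<lambda>a. ?d (a, x, cs)) (coder V dV as) +
      decsum as (\<lambda>u v. decsum cs (\<lambda>p q. smul W (weps V u) (?d (u, ?d (v, x, p), q)))) +
      smul W (weps V as * ?ex) (lin_ext (smul W) (\<lambda>b. ?d (as, x, b)) (coder V dV cs)) = 0"
  proof cases
    case 1
    then show ?thesis unfolding L R using target_relations(1)[OF x] by (simp add: pullback_bimodule_def)
  next
    case 2
    define h where "h = (\<lambda>u v. smul W (weps V u) (?d (u, ?d (v, x, []), [])))"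
    \<comment> \<open>Interior cuts: the products \<open>dW [f u, f v]\<close> from the morphism
      equation cancel the iterated left action by associativity.\<close>
    have "decsum as (\<lambda>u v. if u = [] \<or> v = [] then 0 else dW [dW [f u, f v], x]) +
        decsum as (\<lambda>u v. if u = [] \<or> v = [] then 0 else h u v) = decsum as (\<lambda>u v. 0)"
      unfolding decsum_add[symmetric]
    proof (rule decsum_cong)
      fix u v assume "u @ v = as"
      then have "u \<in> lists (homog V)" "v \<in> lists (homog V)" using as by auto
      then show "(if u = [] \<or> v = [] then 0 else dW [dW [f u, f v], x]) +
          (if u = [] \<or> v = [] then 0 else h u v) = 0"
        using morphism_relations(2)[of u "f v" x] morphism_homog x
        by (simp add: h_def pullback_bimodule_def)
    qed
    \<comment> \<open>The two extreme cuts and the differential of \<open>f as\<close> form the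
      derivation rule for the product of \<open>f as\<close> and x.\<close>
    moreover have "h [] as + h as [] + dW [dW [f as], x] = 0"
      using morphism_relations(1)[OF as 2(1) x] 2(1) by (simp add: h_def pullback_bimodule_def add_ac)
    ultimately show ?thesis
      unfolding L R using 2 morphism_taylor_hlinear[OF target_hlinear(2)[OF x] as 2(1)] decsum_inner[OF 2(1), of h]
      by (simp add: h_def[symmetric] add_ac)
  next
    case 3
    define h where "h = (\<lambda>p q. ?d ([], ?d ([], x, p), q))"
    define k where "k = (\<lambda>p q. if p = [] \<or> q = [] then 0 else dW [x, dW [f p, f q]])"
    have "decsum cs (\<lambda>p q. if p = [] \<or> q = [] then 0 else h p q) + smul W ?ex (decsum cs k) =
        decsum cs (\<lambda>p q. (if p = [] \<or> q = [] then 0 else h p q) + smul W ?ex (k p q))"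
      by (simp add: decsum_eq_sum sum.distrib W.scale_sum_right)
    also have "\<dots> = decsum cs (\<lambda>p q. 0)"
    proof (rule decsum_cong)
      fix p q assume "p @ q = cs"
      then have "p \<in> lists (homog V)" "q \<in> lists (homog V)" using cs by auto
      then show "(if p = [] \<or> q = [] then 0 else h p q) + smul W ?ex (k p q) = 0"
        using target_relations(3)[of x "f p" "f q"] morphism_homog x
        by (simp add: h_def k_def pullback_bimodule_def)
    qed
    finally have "decsum cs (\<lambda>p q. if p = [] \<or> q = [] then 0 else h p q) + smul W ?ex (decsum cs k) = 0" by simp
    moreover have "h [] cs + h cs [] + smul W ?ex (dW [x, dW [f cs]]) = 0"
      using target_relations(2)[OF x morphism_homog[OF cs 3(2)]] 3(2) by (simp add: h_def pullback_bimodule_def)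
    ultimately show ?thesis
      unfolding L R using 3 morphism_taylor_hlinear[OF target_hlinear(3)[OF x] cs 3(2)] decsum_inner[OF 3(2), of h]
      by (simp add: h_def[symmetric] k_def[symmetric] W.scale_right_distrib add_ac)
        (simp add: add.assoc[symmetric] add.commute)
  next
    case 4
    define h where "h = (\<lambda>u v. decsum cs (\<lambda>p q. smul W (weps V u) (?d (u, ?d (v, x, p), q))))"
    have sub: "u \<in> lists (homog V) \<and> v \<in> lists (homog V) \<and> p \<in> lists (homog V) \<and> q \<in> lists (homog V)"
      if "u @ v = as" "p @ q = cs" for u v p q using as cs that by auto
    \<comment> \<open>If q is empty then p = cs and the inner component has arguments on both sides;
      otherwise the outer one has. Either way the term is 0.\<close>
    have "h u v = 0" if uv: "u @ v = as" "u \<noteq> []" "v \<noteq> []" for u v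
    proof -
      have "h u v = decsum cs (\<lambda>p q. 0)" unfolding h_def
      proof (rule decsum_cong)
        fix p q assume pq: "p @ q = cs"
        show "smul W (weps V u) (?d (u, ?d (v, x, p), q)) = 0"
          using sub[OF uv(1) pq] 4 pq uv
          by (cases "q = []") (auto simp: pullback_bimodule_def target_zero morphism_homog)
      qed
      then show ?thesis by simp
    qed
    then have "decsum as h = h [] as + h as []"
      using 4 by (subst decsum_ends) auto
    also have "h [] as = dW [dW [f as, x], f cs]"
    proof -
      have "h [] as = smul W (weps V []) (?d ([], ?d (as, x, []), cs))"
        unfolding h_def
      proof (rule decsum_first)
        fix p q assume "p @ q = cs" "p \<noteq> []"
        then have "?d (as, x, p) = 0" "q \<in> lists (homog V)"
          using 4 cs by (auto simp: pullback_bimodule_def)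
        then show "smul W (weps V []) (?d ([], ?d (as, x, p), q)) = 0"
          using pullback_zero[of "[]" q] by simp
      qed
      then show ?thesis using 4 by (simp add: pullback_bimodule_def)
    qed
    also have "h as [] = smul W (weps V as) (dW [f as, dW [x, f cs]])"
    proof -
      have "h as [] = smul W (weps V as) (?d (as, ?d ([], x, cs), []))"
        unfolding h_def using 4 by (intro decsum_last) (simp add: pullback_bimodule_def)
      then show ?thesis using 4 by (simp add: pullback_bimodule_def)
    qed
    finally show ?thesis
      unfolding L R using 4 morphism_relations(2)[OF as 4(1) x morphism_homog[OF cs 4(2)]]
      by (simp add: h_def)
  qed
  then show ?thesis by (simp add: lin_ext_codiff[OF target_space(3)])
qed

lemma ainf_bimodule_pullback: "ainf_bimodule V dV V dV W (pullback_bimodule dW f)"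
proof -
  have "lin_ext fscal (codiff V dV V dV W (pullback_bimodule dW f))
      (codiff V dV V dV W (pullback_bimodule dW f) w) \<in> rel3 V W V"
    if w: "w \<in> words3 V W V" for w
    by (rule codiff_codiff_rel3[OF V V target_space(1) taylor3_pullback _ w])
      (auto simp: words3_def intro!: pullback_taylor)
  with V target_space(1) taylor3_pullback show ?thesis by (auto simp: ainf_bimodule_def taylor3_def)
qed

text \<open>In a cut of the word into two blocks the marked letter lies in the second or in the
  first one, which gives the left and right action terms; the uncut word gives the differential. So
  this is the morphism equation of f on the whole word.\<close>

lemma pullback_morphism_taylor:
  assumes as: "as \<in> lists (homog V)" and a: "a \<in> homog V" and cs: "cs \<in> lists (homog V)"
  shows "lin_ext (smul W) (pullback_bimodule dW f) (bimod_mor_lift (\<lambda>(as, a, cs). f (as @ a # cs)) (as, a, cs)) =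
    lin_ext (smul W) (\<lambda>(as, a, cs). f (as @ a # cs)) (codiff V dV V dV V (diag_bimodule dV) (as, a, cs))"
proof -
  let ?d = "pullback_bimodule dW f"
  let ?w = "as @ a # cs"
  have w: "?w \<in> lists (homog V)" "?w \<noteq> []" using as a cs by auto
  define k where "k = (\<lambda>u v. decsum cs (\<lambda>p q. ?d (u, f (v @ a # p), q)))"
  \<comment> \<open>A nonempty u forces q to be empty, since a component with arguments on both
    sides vanishes.\<close>
  have k1: "k u v = dW [f u, f (v @ a # cs)]" if "u \<noteq> []" for u v
  proof -
    have "k u v = ?d (u, f (v @ a # cs), [])"
      unfolding k_def using that by (intro decsum_last) (simp add: pullback_bimodule_def)
    then show ?thesis using that by (simp add: pullback_bimodule_def)
  qed
  have "decsum as (\<lambda>u v. k u v - (if u = [] then 0 else k u v)) = k [] as"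
    by (subst decsum_first) auto
  then have A: "decsum as k = k [] as + decsum as (\<lambda>u v. if u = [] then 0 else dW [f u, f (v @ a # cs)])"
    by (simp add: decsum_diff algebra_simps k1 cong: if_cong)
  let ?h = "\<lambda>p q. ?d ([], f (as @ a # p), q)"
  have "decsum cs (\<lambda>p q. ?h p q - (if q = [] then 0 else ?h p q)) = ?h cs []"
    by (subst decsum_last) auto
  then have "decsum cs ?h = ?h cs [] + decsum cs (\<lambda>p q. if q = [] then 0 else ?h p q)"
    by (simp add: decsum_diff algebra_simps)
  then have B: "k [] as = dW [f ?w] + decsum cs (\<lambda>p q. if q = [] then 0 else dW [f (as @ a # p), f q])"
    by (simp add: k_def pullback_bimodule_def cong: if_cong)
  have "hlinear W (smul W) (\<lambda>x. x)" by (simp add: hlinear_def)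
  from morphism_taylor_hlinear[OF this w]
  have "lin_ext (smul W) f (coder V dV ?w) =
      dW [f ?w] + (decsum as (\<lambda>u v. if u = [] then 0 else dW [f u, f (v @ a # cs)]) +
      decsum cs (\<lambda>p q. if q = [] then 0 else dW [f (as @ a # p), f q]))"
    by (simp add: decsum_append_Cons)
  also have "\<dots> = decsum as k" unfolding A B by (simp add: add_ac)
  finally show ?thesis
    by (simp add: lin_ext_bimod_mor_lift[OF target_space(3)] lin_ext_codiff_diag[OF target_space(3)] k_def)
qed

lemma ainf_bimodule_morphism_pullback:
  "ainf_bimodule_morphism V dV V dV V (diag_bimodule dV) W (pullback_bimodule dW f)
     (\<lambda>(as, a, cs). f (as @ a # cs))"
proof -
  let ?F = "\<lambda>(as, a, cs). f (as @ a # cs)"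
  note Vd = ainf_algebraD[OF V]
  have F: "taylor3 V V V W 0 ?F"
    using taylor3_diag[of V W 0 f] ainf_algebra_morphismD[OF f] by simp
  have dM: "taylor3 V V V V 1 (diag_bimodule dV)"
    using taylor3_diag[of V V 1 dV] Vd(2) by (simp add: diag_bimodule_def)
  have "lin_ext fscal (codiff V dV V dV W (pullback_bimodule dW f)) (bimod_mor_lift ?F w)
      - lin_ext fscal (bimod_mor_lift ?F) (codiff V dV V dV V (diag_bimodule dV) w) \<in> rel3 V W V"
    if w: "w \<in> words3 V V V" for w
    by (rule bimod_mor_lift_codiff_rel3[OF V V Vd(1) target_space(1) dM taylor3_pullback F _ w])
      (auto simp: words3_def intro!: pullback_morphism_taylor)
  with F show ?thesis by (simp add: ainf_bimodule_morphism_def taylor3_def)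
qed

end

text \<open>The (0,0)-component is f on single letters, so the isomorphism in cohomology is the one
  of the algebra morphism. The unit acts as the identity because f preserves units, and the
  remaining unit conditions come from the vanishing of f on longer words containing the
  unit.\<close>

theorem su_bimodule_quasi_iso_pullback:
  assumes f: "su_algebra_quasi_iso V dV eV W dW eW f" and dW_3: "\<And>w. length w \<ge> 3 \<Longrightarrow> dW w = 0"
  shows "su_bimodule_quasi_iso V dV eV V dV eV V (diag_bimodule dV) W (pullback_bimodule dW f)
    (\<lambda>(as, a, cs). f (as @ a # cs))"
proof -
  have V: "ainf_algebra V dV" "strictly_unital_algebra V dV eV"
    and W: "ainf_algebra W dW" "strictly_unital_algebra W dW eW"
    and fm: "ainf_algebra_morphism V dV W dW f" and unit: "f [eV] = eW"
    and unit0: "\<And>w. w \<in> lists (homog V) \<Longrightarrow> length w \<ge> 2 \<Longrightarrow> eV \<in> set w \<Longrightarrow> f w = 0"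
    and iso: "induces_cohomology_iso V (\<lambda>x. dV [x]) W (\<lambda>x. dW [x]) (\<lambda>x. f [x])"
    using f unfolding su_algebra_quasi_iso_def by blast+
  note zero = target_zero[OF V(1) W(1) fm dW_3]
  have unital: "strictly_unital_bimodule V eV V eV W (pullback_bimodule dW f)"
    unfolding strictly_unital_bimodule_def
  proof (intro conjI ballI)
    fix m assume "m \<in> homog W"
    then show "pullback_bimodule dW f ([eV], m, []) = m"
      "pullback_bimodule dW f ([], m, [eV]) = smul W ((-1) powi cdeg W m) m"
      using W(2) by (auto simp: pullback_bimodule_def unit strictly_unital_algebra_def)
  next
    fix w assume "w \<in> words3 V W V"
    then obtain as m bs where w: "w = (as, m, bs)" "as \<in> lists (homog V)" "m \<in> homog W" "bs \<in> lists (homog V)"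
      unfolding words3_def by blast
    have "pullback_bimodule dW f (as, m, bs) = 0"
      if "length as + length bs \<ge> 2" "eV \<in> set as \<or> eV \<in> set bs"
      using that w unit0[of as] unit0[of bs] zero
      by (cases "as = []"; cases "bs = []") (auto simp: pullback_bimodule_def)
    then show "case w of (as, m, bs) \<Rightarrow> 2 \<le> length as + length bs \<and> (eV \<in> set as \<or> eV \<in> set bs) \<longrightarrow>
        pullback_bimodule dW f (as, m, bs) = 0"
      by (simp add: w(1))
  qed
  have "f (as @ m # bs) = 0"
    if "as \<in> lists (homog V)" "m \<in> homog V" "bs \<in> lists (homog V)" "length as + length bs \<ge> 1"
      "eV \<in> set as \<or> eV \<in> set bs" for as m bs
    using that by (intro unit0) auto
  moreover have "induces_cohomology_iso V (\<lambda>m. diag_bimodule dV ([], m, [])) W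
      (\<lambda>n. pullback_bimodule dW f ([], n, [])) (\<lambda>m. f [m])"
    using iso by (simp add: diag_bimodule_def pullback_bimodule_def)
  ultimately show ?thesis
    using V ainf_bimodule_diag[OF V(1)] strictly_unital_bimodule_diag[OF V(2)] unital
      ainf_bimodule_pullback[OF V(1) W(1) fm dW_3] ainf_bimodule_morphism_pullback[OF V(1) W(1) fm dW_3]
    by (auto simp: su_bimodule_quasi_iso_def su_ainf_bimodule_def words3_def)
qed

lemma cffr_derived_left_quasi_iso:
  assumes "cffr_bimodule sX dK"
  shows "su_algebra_quasi_iso (SymAlg sX) (SymAlg_taylor sX) 1 (EndR (ExtAlg sX) KK)
    (EndR_taylor (ExtAlg sX) (ExtAlg_taylor sX) KK dK) (EndR_unit (ExtAlg sX) KK)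
    (derived_left (ExtAlg sX) KK dK)"
  using assms unfolding cffr_bimodule_def Let_def by blast

theorem proposition6:
  fixes scaleX :: "'k::real_or_complex \<Rightarrow> 'x::ab_group_add \<Rightarrow> 'x"
    and Basis :: "'x set"
    and dK :: "('x \<Rightarrow> 'k) list \<times> 'k \<times> (('x list \<Rightarrow> 'k) \<Rightarrow> 'k) list \<Rightarrow> 'k"
  assumes X: "finite_dimensional_vector_space scaleX Basis"
    and A: "A = SymAlg scaleX" "dA = SymAlg_taylor scaleX"
    and B: "B = ExtAlg scaleX" "dB = ExtAlg_taylor scaleX"
    and K: "cffr_bimodule scaleX dK"
    and E: "E = EndR B KK"
    and L: "L = derived_left B KK dK"
  shows "\<exists>dE.
    su_ainf_bimodule A dA 1 A dA 1 E dE \<and>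
    su_bimodule_quasi_iso A dA 1 A dA 1 A (diag_bimodule dA) E dE (\<lambda>(as, a, cs). L (as @ a # cs)) \<and>
    (\<forall>\<phi>\<in>homog E. dE ([], \<phi>, []) = - partialR B dB KK dK \<phi>) \<and>
    (\<forall>as\<in>lists (homog A). \<forall>\<phi>\<in>homog E. as \<noteq> [] \<longrightarrow>
       dE (as, \<phi>, []) = smul E ((-1) powi (sdeg A as - 1)) (compR KK (L as) \<phi>)) \<and>
    (\<forall>cs\<in>lists (homog A). \<forall>\<phi>\<in>homog E. cs \<noteq> [] \<longrightarrow>
       dE ([], \<phi>, cs) = smul E ((-1) powi (cdeg E \<phi>)) (compR KK \<phi> (L cs))) \<and>
    (\<forall>as\<in>lists (homog A). \<forall>\<phi>\<in>homog E. \<forall>cs\<in>lists (homog A). as \<noteq> [] \<and> cs \<noteq> [] \<longrightarrow>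
       dE (as, \<phi>, cs) = 0)"
proof -
  define dE where "dE = EndR_taylor B dB KK dK"
  have q: "su_algebra_quasi_iso A dA 1 E dE (EndR_unit B KK) L"
    using cffr_derived_left_quasi_iso[OF K] by (simp add: A B E L dE_def)
  have dE_3: "dE w = 0" if "length w \<ge> 3" for w
    using that by (auto simp: dE_def EndR_taylor_def split: list.splits)
  have As: "bigraded_space A" and Es: "bigraded_space E" and Lt: "taylor_T A E 1 L"
    using q ainf_algebraD(1) ainf_algebra_morphismD unfolding su_algebra_quasi_iso_def by blast+
  note qi = su_bimodule_quasi_iso_pullback[OF q dE_3]
  have left: "dE [L as, \<phi>] = smul E ((-1) powi (sdeg A as - 1)) (compR KK (L as) \<phi>)"
    if as: "as \<in> lists (homog A)" "as \<noteq> []" for as \<phi>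
  \<comment> \<open>If \<open>L as = 0\<close> its default degree need not match the stated sign,
    but both sides are 0.\<close>
  proof (cases "L as = 0")
    case True
    have "compR KK (0 :: 'k \<times> _ \<Rightarrow> 'k) \<phi> = 0"
      by (rule ext) (simp add: compR_def lin_ext_def KK_def)
    then show ?thesis
      using True by (simp add: dE_def EndR_taylor_def E EndR_def KK_def zero_fun_def)
  next
    case False
    \<comment> \<open>The exponents \<open>sdeg A as + 1\<close> and \<open>sdeg A as - 1\<close>
      have the same parity, so the sign of the composition is the stated one.\<close>
    have "cdeg E (L as) = sdeg A as + 1" by (rule cdeg_taylor_T[OF As Es Lt as(2,1) False])
    then show ?thesis by (simp add: dE_def EndR_taylor_def power_int_add power_int_diff flip: E)
  qed
  have "su_ainf_bimodule A dA 1 A dA 1 E (pullback_bimodule dE L)"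
    using qi unfolding su_bimodule_quasi_iso_def by blast
  with qi show ?thesis
    by (intro exI[of _ "pullback_bimodule dE L"])
      (auto simp: pullback_bimodule_def left, auto simp: dE_def EndR_taylor_def simp flip: E)
qed

end
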